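(* Let $\Omega$ and $\{(\Omega_h,\mathcal T_h)\}_h$ be as in the context. For $N_h\in X(\mathcal T_h)$ put $\mu_e^q:=\int_eq_n(N_h)\,ds$ for $e\in\mathcal E_h^\partial$ and $$p_h^q:=\tfrac12\sum_{e\in\mathcal E_h^\partial}h_e\,\mu_e^q\,b_e\,t_e .$$ Then $\operatorname{sCurl}p_h^q\in\Sigma_h^{nn}\cap\ker(\operatorname{divdiv})$, $$(\operatorname{sCurl}p_h^q)_{nn}|_e=0,\qquad \int_eq_n(\operatorname{sCurl}p_h^q)\,ds=\mu_e^q\qquad\forall e\in\mathcal E_h^\partial,$$ and, with a constant $C$ independent of $h$ and $N_h$, $$\|\operatorname{sCurl}p_h^q\|_{L^2(\Omega_h)}\le C\Bigl(\sum_{e\in\mathcal E_h^\partial}h_e^2|\mu_e^q|^2\Bigr)^{1/2}.$$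
   Context: Geometry and meshes. $\Omega\subset\mathbb R^2$ is a bounded connected Lipschitz domain whose boundary has finitely many connected components, $\Gamma:=\partial\Omega=\bigcup_{i=0}^{H}\Gamma^{(i)}$. For every sufficiently small mesh size $h$, $\Omega_h$ is a bounded polygonal Lipschitz domain with boundary $\Gamma_h=\bigcup_{i=0}^{H}\Gamma_h^{(i)}$ and $\mathcal T_h$ is a conforming triangulation of $\Omega_h$. $\mathcal E_h^\partial$ and $\mathcal V_h^\partial$ are the sets of boundary edges and boundary vertices, $h_K:=\operatorname{diam}K$, $h_e:=|e|$, $h:=\max_{K}h_K$. Each $\Gamma^{(i)}$ is oriented so that $\Omega$ lies to its right, and $\Gamma_h^{(i)}$ is oriented as $\Gamma^{(i)}$; on $e\in\mathcal E_h^\partial$, $t=t_e$ and $n=n_e$ are the constant unit tangent and outward unit normal (so $n_e$ is $t_e$ rotated counterclockwise by $\pi/2$). Mesh assumption: $\{\mathcal T_h\}_h$ is uniformly shape regular and quasi-uniform, $h\to0$ and $\Gamma_h\to\Gamma$ in Hausdorff distance; on each component the vertices of $\Gamma_h^{(i)}$ lie on $\Gamma^{(i)}$ in the same cyclic order, with consecutive vertices joined by boundary edges (so $\mathcal V_h^\partial\subset\Gamma$). Notation. $\mathbb S$: symmetric $2\times2$ real matrices; $\operatorname{div}$ acts row-wise on tensors; $\operatorname{divdiv}N:=\operatorname{div}(\operatorname{div}N)$ (distributional); $H(\operatorname{divdiv},\omega;\mathbb S):=\{N\in L^2(\omega;\mathbb S):\operatorname{divdiv}N\in L^2(\omega)\}$.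 On a straight edge: $N_{nn}:=n^\top Nn$, $N_{nt}:=n^\top Nt$, $q_n(N):=n\cdot\operatorname{div}N+\partial_tN_{nt}$ (computed from the adjacent element). For $p=(p_1,p_2)^\top$, $\operatorname{Curl}p:=\begin{pmatrix}\partial_2p_1&-\partial_1p_1\\ \partial_2p_2&-\partial_1p_2\end{pmatrix}$ and $\operatorname{sCurl}p:=\frac12(\operatorname{Curl}p+(\operatorname{Curl}p)^\top)$. Spaces and bubbles. $\operatorname{RT}^k(K):=\mathbb P_k(K;\mathbb R^2)+x\,\mathbb P_k(K)$, $X(K):=\operatorname{sym}(\operatorname{RT}^0(K)\otimes\operatorname{RT}^1(K))$, where $U\otimes V$ is the span of $\{\phi\psi^\top:\phi\in U,\psi\in V\}$ and $\operatorname{sym}Q:=(Q+Q^\top)/2$; $X(\mathcal T_h):=\{N_h\in H(\operatorname{divdiv},\Omega_h;\mathbb S):N_h|_K\in X(K)\ \forall K\in\mathcal T_h\}$; $\Sigma_h^{nn}:=\{N_h\in X(\mathcal T_h):N_{h,nn}|_e=0\ \forall e\in\mathcal E_h^\partial\}$. For $e=[z_i,z_j]\in\mathcal E_h^\partial$ with adjacent element $K_e$, $b_e:=\lambda_i\lambda_j$ on $K_e$ ($\lambda_i,\lambda_j$ the barycentric coordinates of $K_e$ associated with $z_i,z_j$), extended by zero elsewhere. *)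

theory Defs
  imports "HOL-Analysis.Analysis"
begin

section \<open>Differential operators in the plane\<close>

text \<open>\<open>pd j f\<close> is the classical partial derivative. Where \<open>f\<close> is not differentiable its value is
  arbitrary; for the piecewise polynomial fields below this happens at most on the null set of
  element edges, so that it represents the weak derivative of a piecewise polynomial field that is
  continuous in the open domain.\<close>

definition pd :: "2 \<Rightarrow> (real^2 \<Rightarrow> real) \<Rightarrow> real^2 \<Rightarrow> real" where
  "pd j f x = frechet_derivative f (at x) (axis j 1)"

definition dir_deriv :: "real^2 \<Rightarrow> (real^2 \<Rightarrow> real) \<Rightarrow> real^2 \<Rightarrow> real" where
  "dir_deriv v f x = frechet_derivative f (at x) v"

definition row_div :: "(real^2 \<Rightarrow> real^2^2) \<Rightarrow> real^2 \<Rightarrow> real^2" where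
  "row_div N x = (\<chi> i. \<Sum>j\<in>UNIV. pd j (\<lambda>y. N y $ i $ j) x)"

definition Curl :: "(real^2 \<Rightarrow> real^2) \<Rightarrow> real^2 \<Rightarrow> real^2^2" where
  "Curl p x = (\<chi> i. vector [pd 2 (\<lambda>y. p y $ i) x, - pd 1 (\<lambda>y. p y $ i) x])"

definition symm :: "real^2^2 \<Rightarrow> real^2^2" where
  "symm Q = (1/2) *\<^sub>R (Q + transpose Q)"

definition sCurl :: "(real^2 \<Rightarrow> real^2) \<Rightarrow> real^2 \<Rightarrow> real^2^2" where
  "sCurl p x = symm (Curl p x)"

definition hessian :: "(real^2 \<Rightarrow> real) \<Rightarrow> real^2 \<Rightarrow> real^2^2" where
  "hessian f x = (\<chi> i j. pd i (pd j f) x)"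

text \<open>Counterclockwise rotation by \<open>\<pi>/2\<close>.\<close>

definition rot90 :: "real^2 \<Rightarrow> real^2" where
  "rot90 v = vector [- v$2, v$1]"

section \<open>Square-integrable fields and the distributional \<open>divdiv\<close>\<close>

definition L2 :: "(real^2) set \<Rightarrow> (real^2 \<Rightarrow> 'a::euclidean_space) \<Rightarrow> bool" where
  "L2 D f \<longleftrightarrow> f \<in> borel_measurable (lebesgue_on D) \<and> integrable (lebesgue_on D) (\<lambda>x. (norm (f x))\<^sup>2)"

text \<open>On \<^typ>\<open>real^2^2\<close>, \<^const>\<open>norm\<close> and \<^const>\<open>inner\<close> are the Frobenius norm and product.\<close>

definition L2_norm_on :: "(real^2) set \<Rightarrow> (real^2 \<Rightarrow> 'a::euclidean_space) \<Rightarrow> real" where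
  "L2_norm_on D f = sqrt (integral\<^sup>L (lebesgue_on D) (\<lambda>x. (norm (f x))\<^sup>2))"

primrec Ck :: "nat \<Rightarrow> (real^2 \<Rightarrow> real) \<Rightarrow> bool" where
  "Ck 0 f \<longleftrightarrow> continuous_on UNIV f"
| "Ck (Suc k) f \<longleftrightarrow> (\<forall>x. f differentiable (at x)) \<and> (\<forall>j. Ck k (pd j f))"

definition test_function :: "(real^2) set \<Rightarrow> (real^2 \<Rightarrow> real) \<Rightarrow> bool" where
  "test_function D \<phi> \<longleftrightarrow>
     (\<forall>k. Ck k \<phi>) \<and> compact (closure {x. \<phi> x \<noteq> 0}) \<and> closure {x. \<phi> x \<noteq> 0} \<subseteq> D"

definition weak_divdiv :: "(real^2) set \<Rightarrow> (real^2 \<Rightarrow> real^2^2) \<Rightarrow> (real^2 \<Rightarrow> real) \<Rightarrow> bool" where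
  "weak_divdiv D N g \<longleftrightarrow> (\<forall>\<phi>. test_function D \<phi> \<longrightarrow>
     integral\<^sup>L (lebesgue_on D) (\<lambda>x. N x \<bullet> hessian \<phi> x) = integral\<^sup>L (lebesgue_on D) (\<lambda>x. g x * \<phi> x))"

definition Hdivdiv :: "(real^2) set \<Rightarrow> (real^2 \<Rightarrow> real^2^2) set" where
  "Hdivdiv D = {N. L2 D N \<and> (AE x in lebesgue_on D. transpose (N x) = N x) \<and>
                   (\<exists>g. L2 D g \<and> weak_divdiv D N g)}"

definition ker_divdiv :: "(real^2) set \<Rightarrow> (real^2 \<Rightarrow> real^2^2) set" where
  "ker_divdiv D = {N \<in> Hdivdiv D. weak_divdiv D N (\<lambda>_. 0)}"

section \<open>Domains and boundary orientation\<close>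

text \<open>Near each boundary point, the domain is the strict epigraph of a Lipschitz function in the
  Cartesian coordinates given by \<open>rot90 u\<close> (abscissa) and \<open>u\<close> (ordinate).\<close>

definition bounded_lipschitz_domain :: "(real^2) set \<Rightarrow> bool" where
  "bounded_lipschitz_domain D \<longleftrightarrow>
     open D \<and> bounded D \<and> connected D \<and> D \<noteq> {} \<and>
     (\<forall>x \<in> frontier D. \<exists>r u g L. r > 0 \<and> norm u = 1 \<and> L-lipschitz_on UNIV (g :: real \<Rightarrow> real) \<and>
        D \<inter> ball x r = {y \<in> ball x r. g (y \<bullet> rot90 u) < y \<bullet> u})"

definition polygonal_boundary :: "(real^2) set \<Rightarrow> bool" where
  "polygonal_boundary D \<longleftrightarrow>
     (\<exists>S. finite S \<and> (\<forall>s\<in>S. \<exists>a b. s = closed_segment a b) \<and> frontier D = \<Union>S)"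

text \<open>A Lipschitz parametrization of the closed curve \<open>C\<close> traversed with \<open>D\<close> on its right: at almost
  every parameter the velocity exists, is nonzero, and its clockwise normal points into \<open>D\<close>.\<close>

definition right_oriented_param :: "(real^2) set \<Rightarrow> (real^2) set \<Rightarrow> (real \<Rightarrow> real^2) \<Rightarrow> bool" where
  "right_oriented_param D C \<gamma> \<longleftrightarrow>
     simple_path \<gamma> \<and> pathfinish \<gamma> = pathstart \<gamma> \<and> path_image \<gamma> = C \<and>
     (\<exists>L. L-lipschitz_on {0..1} \<gamma>) \<and>
     (AE s in lebesgue_on {0<..<1}. \<exists>v. v \<noteq> 0 \<and> (\<gamma> has_vector_derivative v) (at s) \<and>
        (\<forall>\<^sub>F \<epsilon> in at_right 0. \<gamma> s - \<epsilon> *\<^sub>R rot90 v \<in> D))"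

definition hausdorff_distance :: "(real^2) set \<Rightarrow> (real^2) set \<Rightarrow> real" where
  "hausdorff_distance A B = max (SUP x\<in>A. infdist x B) (SUP y\<in>B. infdist y A)"

section \<open>Triangulations\<close>

definition conforming_triangulation :: "(real^2) set \<Rightarrow> (real^2) set set \<Rightarrow> bool" where
  "conforming_triangulation D T \<longleftrightarrow>
     triangulation T \<and> (\<forall>K\<in>T. 2 simplex K) \<and> \<Union>T = closure D"

definition vertices :: "(real^2) set \<Rightarrow> (real^2) set" where
  "vertices P = {z. z extreme_point_of P}"

definition bd_edges :: "(real^2) set \<Rightarrow> (real^2) set set \<Rightarrow> (real^2) set set" where
  "bd_edges D T = {e. e \<subseteq> frontier D \<and> (\<exists>K\<in>T. e edge_of K)}"

definition bd_vertices :: "(real^2) set \<Rightarrow> (real^2) set set \<Rightarrow> (real^2) set" where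
  "bd_vertices D T = {z \<in> frontier D. \<exists>K\<in>T. z \<in> vertices K}"

definition mesh_size :: "(real^2) set set \<Rightarrow> real" where
  "mesh_size T = Max (diameter ` T)"

definition inscribed_diameter :: "(real^2) set \<Rightarrow> real" where
  "inscribed_diameter K = Sup {2 * r |r x. 0 \<le> r \<and> cball x r \<subseteq> K}"

definition uniformly_shape_regular :: "real set \<Rightarrow> (real \<Rightarrow> (real^2) set set) \<Rightarrow> bool" where
  "uniformly_shape_regular I T \<longleftrightarrow>
     (\<exists>\<sigma>>0. \<forall>h\<in>I. \<forall>K\<in>T h. diameter K \<le> \<sigma> * inscribed_diameter K)"

definition quasi_uniform :: "real set \<Rightarrow> (real \<Rightarrow> (real^2) set set) \<Rightarrow> bool" where
  "quasi_uniform I T \<longleftrightarrow> (\<exists>c>0. \<forall>h\<in>I. \<forall>K\<in>T h. mesh_size (T h) \<le> c * diameter K)"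

text \<open>For a boundary edge the adjacent element is unique.\<close>

definition adj_elem :: "(real^2) set set \<Rightarrow> (real^2) set \<Rightarrow> (real^2) set" where
  "adj_elem T e = (THE K. K \<in> T \<and> e edge_of K)"

definition outward_normal :: "(real^2) set set \<Rightarrow> (real^2) set \<Rightarrow> real^2" where
  "outward_normal T e = (THE n. norm n = 1 \<and> (\<forall>x\<in>e. \<forall>y\<in>e. n \<bullet> (y - x) = 0) \<and>
                               (\<forall>x\<in>e. \<forall>y\<in>adj_elem T e. n \<bullet> (y - x) \<le> 0))"

text \<open>The tangent \<open>t\<^sub>e\<close> for which the outward normal is \<open>rot90 t\<^sub>e\<close>, that is, the direction of
  traversal with the polygonal domain on the right.\<close>

definition tangent :: "(real^2) set set \<Rightarrow> (real^2) set \<Rightarrow> real^2" where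
  "tangent T e = - rot90 (outward_normal T e)"

text \<open>The vertices of the polygonal boundary component \<open>Ch\<close>, listed along the parametrization \<open>\<gamma>\<close> of
  the corresponding component of the exact boundary, are joined cyclically by the edges of \<open>Ch\<close>.
  The last conjunct says that \<open>Ch\<close> and \<open>\<gamma>\<close> have the same orientation.\<close>

definition interpolates_component ::
  "(real^2) set \<Rightarrow> (real^2) set set \<Rightarrow> (real^2) set \<Rightarrow> (real \<Rightarrow> real^2) \<Rightarrow> bool" where
  "interpolates_component D T Ch \<gamma> \<longleftrightarrow>
     (\<exists>m s. 0 < m \<and> strict_mono_on {..<m} s \<and> s ` {..<m} \<subseteq> {0..<1} \<and>
        bd_vertices D T \<inter> Ch = (\<lambda>j. \<gamma> (s j)) ` {..<m} \<and>
        {e \<in> bd_edges D T. e \<subseteq> Ch}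
          = (\<lambda>j. closed_segment (\<gamma> (s j)) (\<gamma> (s (Suc j mod m)))) ` {..<m} \<and>
        (\<forall>j<m. tangent T (closed_segment (\<gamma> (s j)) (\<gamma> (s (Suc j mod m))))
                 = sgn (\<gamma> (s (Suc j mod m)) - \<gamma> (s j))))"

text \<open>Arc length integral; it does not depend on the order of the two endpoints.\<close>

definition edge_integral :: "(real^2) set \<Rightarrow> (real^2 \<Rightarrow> real) \<Rightarrow> real" where
  "edge_integral e f = (let (a, b) = (SOME (a, b). e = closed_segment a b)
     in dist a b * integral {0..1} (\<lambda>s. f ((1 - s) *\<^sub>R a + s *\<^sub>R b)))"

section \<open>The finite element spaces\<close>

text \<open>Polynomial spaces on an element are represented by the spaces of the polynomial functions on the
  whole plane; since elements have nonempty interior, restriction to an element is injective on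
  them. Hence the element does not occur as a parameter.\<close>

definition Pk :: "nat \<Rightarrow> (real^2 \<Rightarrow> real) set" where
  "Pk k = {f. \<exists>c. f = (\<lambda>x. \<Sum>i\<le>k. \<Sum>j\<le>k - i. c i j * (x$1)^i * (x$2)^j)}"

definition RT :: "nat \<Rightarrow> (real^2 \<Rightarrow> real^2) set" where
  "RT k = {\<lambda>x. v x + q x *\<^sub>R x |v q. (\<forall>i. (\<lambda>x. v x $ i) \<in> Pk k) \<and> q \<in> Pk k}"

definition outer_product :: "real^2 \<Rightarrow> real^2 \<Rightarrow> real^2^2" where
  "outer_product a b = (\<chi> i j. a $ i * b $ j)"

definition tensor_space ::
  "(real^2 \<Rightarrow> real^2) set \<Rightarrow> (real^2 \<Rightarrow> real^2) set \<Rightarrow> (real^2 \<Rightarrow> real^2^2) set" where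
  "tensor_space U V = {\<lambda>x. \<Sum>k<m. c k *\<^sub>R outer_product (\<phi> k x) (\<psi> k x) |(m::nat) c \<phi> \<psi>.
                         (\<forall>k<m. \<phi> k \<in> U \<and> \<psi> k \<in> V)}"

definition X_elem :: "(real^2 \<Rightarrow> real^2^2) set" where
  "X_elem = {\<lambda>x. symm (Q x) |Q. Q \<in> tensor_space (RT 0) (RT 1)}"

definition X_space :: "(real^2) set \<Rightarrow> (real^2) set set \<Rightarrow> (real^2 \<Rightarrow> real^2^2) set" where
  "X_space D T = {N \<in> Hdivdiv D. \<forall>K\<in>T. \<exists>P\<in>X_elem. AE x in lebesgue_on K. N x = P x}"

text \<open>The polynomial representing \<open>N\<close> on \<open>K\<close>. Edge quantities are computed from the one of the
  adjacent element.\<close>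

definition elem_part :: "(real^2) set \<Rightarrow> (real^2 \<Rightarrow> real^2^2) \<Rightarrow> real^2 \<Rightarrow> real^2^2" where
  "elem_part K N = (THE P. P \<in> X_elem \<and> (AE x in lebesgue_on K. N x = P x))"

definition nn_trace ::
  "(real^2) set set \<Rightarrow> (real^2) set \<Rightarrow> (real^2 \<Rightarrow> real^2^2) \<Rightarrow> real^2 \<Rightarrow> real" where
  "nn_trace T e N x = (let n = outward_normal T e in n \<bullet> (elem_part (adj_elem T e) N x *v n))"

definition nt_trace ::
  "(real^2) set set \<Rightarrow> (real^2) set \<Rightarrow> (real^2 \<Rightarrow> real^2^2) \<Rightarrow> real^2 \<Rightarrow> real" where
  "nt_trace T e N x = outward_normal T e \<bullet> (elem_part (adj_elem T e) N x *v tangent T e)"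

definition q_n ::
  "(real^2) set set \<Rightarrow> (real^2) set \<Rightarrow> (real^2 \<Rightarrow> real^2^2) \<Rightarrow> real^2 \<Rightarrow> real" where
  "q_n T e N x = outward_normal T e \<bullet> row_div (elem_part (adj_elem T e) N) x
                 + dir_deriv (tangent T e) (nt_trace T e N) x"

definition Sigma_nn :: "(real^2) set \<Rightarrow> (real^2) set set \<Rightarrow> (real^2 \<Rightarrow> real^2^2) set" where
  "Sigma_nn D T = {N \<in> X_space D T. \<forall>e\<in>bd_edges D T. \<forall>x\<in>e. nn_trace T e N x = 0}"

section \<open>Edge bubbles\<close>

definition bary :: "(real^2) set \<Rightarrow> real^2 \<Rightarrow> real^2 \<Rightarrow> real" where
  "bary K z = (THE l. (\<exists>a c. l = (\<lambda>x. a \<bullet> x + c)) \<and> l z = 1 \<and>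
                      (\<forall>w \<in> vertices K - {z}. l w = 0))"

definition edge_bubble :: "(real^2) set set \<Rightarrow> (real^2) set \<Rightarrow> real^2 \<Rightarrow> real" where
  "edge_bubble T e x = (if x \<in> adj_elem T e
     then \<Prod>z\<in>vertices e. bary (adj_elem T e) z x else 0)"

end

theory Submission
  imports Defs
begin

text \<open>On a triangle \<open>K\<close> the field \<open>p\<close> is a combination of the fields \<open>\<lambda>\<^sub>a \<lambda>\<^sub>b t\<^sub>e\<close>, one for each boundary edge
\<open>e = [a,b]\<close> of \<open>K\<close>. Hence \<open>sCurl p\<close> is affine on \<open>K\<close>, and all claims except the norm bound are linear in
the contributions of the single edges.

The double divergence of \<open>sCurl p\<close> vanishes formally, because moving one derivative to the test
function \<open>\<phi>\<close> leaves differences of equal third derivatives of \<open>\<phi>\<close>. No distribution concentrated on an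
edge is left over: on the boundary of \<open>K\<close> the bubble of \<open>e\<close> is zero except on \<open>e\<close>, and \<open>e\<close> lies in the
boundary of the domain, where \<open>\<phi>\<close> is zero together with its derivatives. So the bubble times a second
derivative of \<open>\<phi>\<close> is a \<open>C\<^sup>1\<close> function that is zero on the boundary of \<open>K\<close>, and the integrals over \<open>K\<close> of its
partial derivatives are zero (\<open>integral_pd_eq_0\<close>, \<open>integral_bubble_stress_hessian\<close>).

For the traces, let \<open>n\<close> be a unit vector and \<open>t = - rot90 n\<close>. Then the \<open>nn\<close> component of \<open>sCurl p\<close> is
\<open>- n \<bullet> \<partial>\<^sub>t p\<close>, and \<open>q\<^sub>n(sCurl p) = - \<partial>\<^sub>t\<^sub>t (p \<bullet> t)\<close> (\<open>nn_bubble_stress\<close>, \<open>qn_form_bubble\<close>). On an edge \<open>e\<close> both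
depend only on the restriction of \<open>p\<close> to the line through \<open>e\<close>. The bubbles of the other edges of \<open>K\<close>
contain the barycentric coordinate of the vertex opposite to \<open>e\<close> and are zero on this line. The bubble
of \<open>e\<close> points in the direction \<open>t\<^sub>e\<close>, so it has no \<open>nn\<close> trace, and along \<open>e\<close> it is a parabola with second
derivative \<open>- 2 / h\<^sub>e\<^sup>2\<close>. With the weight \<open>w\<close> it yields \<open>q\<^sub>n = 2 w / h\<^sub>e\<^sup>2\<close>, whose integral over \<open>e\<close> is \<open>2 w / h\<^sub>e\<close>;
this is \<open>\<mu>\<^sub>e\<close> for \<open>w = h\<^sub>e \<mu>\<^sub>e / 2\<close> (\<open>edge_traces\<close>, \<open>edge_integral_q_n_bubble_field\<close>).

The norm bound comes from scaling. A barycentric coordinate increases by at most one along a diameter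
of an inscribed disc, so its gradient is at most \<open>\<sigma> / h\<^sub>K\<close> with the
shape regularity constant \<open>\<sigma>\<close>, while the area of \<open>K\<close> is at most \<open>\<pi> h\<^sub>K\<^sup>2\<close>, and at
most three boundary edges contribute on \<open>K\<close> (\<open>L2_norm_sCurl_bubble_field_le\<close>).

Two facts make the edge quantities meaningful. A boundary edge has only one adjacent element: two
triangles that share \<open>e\<close> without overlapping lie on different sides of \<open>e\<close>, so the midpoint of \<open>e\<close> would be
interior to the closure of the domain, which the epigraph description excludes at boundary points
(\<open>boundary_edge_elem_unique\<close>). And the polynomial that represents a field on an element is unique,
because a polynomial that is zero almost everywhere on a set with interior points is the zero
polynomial (\<open>X_elem_AE_unique\<close>).\<close>

section \<open>Partial derivatives of smooth functions\<close>

lemma pd_has_derivative: "(f has_derivative f') (at x) \<Longrightarrow> pd j f x = f' (axis j 1)"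
  by (simp add: pd_def frechet_derivative_at[symmetric])

lemma pd_cong_nhds:
  assumes ev: "\<forall>\<^sub>F y in nhds x. f y = g y" shows "pd j f x = pd j g x"
proof -
  have at: "\<forall>\<^sub>F y in at x. f y = g y" "\<forall>\<^sub>F y in at x. g y = f y" and x: "f x = g x"
    using ev eventually_nhds_x_imp_x[OF ev] by (auto simp: eventually_nhds_conv_at eq_commute)
  have "(f has_derivative f') (at x) \<longleftrightarrow> (g has_derivative f') (at x)" for f'
    using has_derivative_transform_eventually[OF _ at(1) x UNIV_I]
      has_derivative_transform_eventually[OF _ at(2) x[symmetric] UNIV_I] by blast
  then show ?thesis by (simp add: pd_def frechet_derivative_def)
qed

lemma sCurl_cong_nhds:
  assumes "\<forall>\<^sub>F y in nhds x. p y = q y" shows "sCurl p x = sCurl q x"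
proof -
  have "pd j (\<lambda>y. p y $ i) x = pd j (\<lambda>y. q y $ i) x" for i j
    by (rule pd_cong_nhds) (use assms in \<open>auto elim: eventually_mono\<close>)
  then show ?thesis by (simp add: sCurl_def Curl_def)
qed

lemma DERIV_along_axis:
  assumes "\<And>x. f differentiable (at x)"
  shows "((\<lambda>s. f (x + s *\<^sub>R axis j 1)) has_real_derivative pd j f (x + s *\<^sub>R axis j 1)) (at s)"
proof -
  let ?z = "x + s *\<^sub>R axis j 1"
  have f: "(f has_derivative frechet_derivative f (at ?z)) (at ?z)"
    using assms frechet_derivative_works by blast
  have "((\<lambda>s. x + s *\<^sub>R axis j 1) has_derivative (\<lambda>s. s *\<^sub>R axis j 1)) (at s)"
    by (auto intro!: derivative_eq_intros)
  from diff_chain_at[OF this f]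
  have "((\<lambda>s. f (x + s *\<^sub>R axis j 1)) has_derivative (\<lambda>s. frechet_derivative f (at ?z) (s *\<^sub>R axis j 1))) (at s)"
    by (simp add: o_def)
  moreover have "linear (frechet_derivative f (at ?z))"
    using f has_derivative_linear by blast
  ultimately show ?thesis
    by (simp add: has_field_derivative_def pd_def linear_cmul mult.commute[of _ "frechet_derivative _ _ _"])
qed

lemma MVT_along_axis:
  assumes "\<And>x. f differentiable (at x)" "0 < s"
  obtains \<xi> where "0 < \<xi>" "\<xi> < s" "f (x + s *\<^sub>R axis j 1) - f x = s * pd j f (x + \<xi> *\<^sub>R axis j 1)"
proof -
  have "\<exists>z>0. z < s \<and> f (x + s *\<^sub>R axis j 1) - f (x + 0 *\<^sub>R axis j 1) = (s - 0) * pd j f (x + z *\<^sub>R axis j 1)"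
    by (rule MVT2[OF \<open>0 < s\<close>]) (use DERIV_along_axis[OF assms(1)] in blast)
  then show ?thesis using that by auto
qed

definition smooth :: "(real^2 \<Rightarrow> real) \<Rightarrow> bool" where
  "smooth f \<longleftrightarrow> (\<forall>k. Ck k f)"

lemma smooth_differentiable: "smooth f \<Longrightarrow> f differentiable (at x)"
  unfolding smooth_def using Ck.simps(2) by blast

lemma smooth_pd: "smooth f \<Longrightarrow> smooth (pd j f)"
  unfolding smooth_def by (metis Ck.simps(2))

lemma smooth_continuous: "smooth f \<Longrightarrow> continuous_on UNIV f"
  unfolding smooth_def by (metis Ck.simps(1))

text \<open>The second difference is symmetric in \<open>i\<close> and \<open>j\<close>, the mixed partial derivative on the right is not:
this is what makes mixed partial derivatives commute. Apply the mean value theorem in direction \<open>i\<close>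
to the difference in direction \<open>j\<close>, then once more in direction \<open>j\<close>.\<close>

lemma second_difference_eq_mixed_partial:
  assumes f: "smooth f" and s: "0 < s"
  obtains \<xi> \<eta> where "0 < \<xi>" "\<xi> < s" "0 < \<eta>" "\<eta> < s"
    "f (x + s *\<^sub>R axis i 1 + s *\<^sub>R axis j 1) - f (x + s *\<^sub>R axis i 1) - f (x + s *\<^sub>R axis j 1) + f x
       = s\<^sup>2 * pd j (pd i f) (x + \<xi> *\<^sub>R axis i 1 + \<eta> *\<^sub>R axis j 1)"
proof -
  let ?g = "\<lambda>r. f (x + s *\<^sub>R axis j 1 + r *\<^sub>R axis i 1) - f (x + r *\<^sub>R axis i 1)"
  note d = DERIV_along_axis[OF smooth_differentiable[OF f]]
  have "\<exists>z>0. z < s \<and> ?g s - ?g 0 = (s - 0) *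
      (pd i f (x + s *\<^sub>R axis j 1 + z *\<^sub>R axis i 1) - pd i f (x + z *\<^sub>R axis i 1))"
    by (rule MVT2[OF s]) (intro DERIV_diff d)
  then obtain \<xi> where \<xi>: "0 < \<xi>" "\<xi> < s" and 1: "?g s - ?g 0 = s *
      (pd i f (x + \<xi> *\<^sub>R axis i 1 + s *\<^sub>R axis j 1) - pd i f (x + \<xi> *\<^sub>R axis i 1))"
    by (auto simp: add_ac)
  obtain \<eta> where \<eta>: "0 < \<eta>" "\<eta> < s" and 2:
      "pd i f (x + \<xi> *\<^sub>R axis i 1 + s *\<^sub>R axis j 1) - pd i f (x + \<xi> *\<^sub>R axis i 1)
        = s * pd j (pd i f) (x + \<xi> *\<^sub>R axis i 1 + \<eta> *\<^sub>R axis j 1)"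
    by (rule MVT_along_axis[OF smooth_differentiable[OF smooth_pd[OF f]] s])
  show ?thesis
    by (rule that[OF \<xi> \<eta>]) (use 1 2 in \<open>simp add: power2_eq_square algebra_simps\<close>)
qed

lemma mixed_partials_commute:
  assumes f: "smooth f"
  shows "pd i (pd j f) x = pd j (pd i f) x"
proof -
  \<comment> \<open>The second difference of \<open>f\<close> at \<open>x\<close> for the step \<open>s\<close>; it is unchanged when \<open>i\<close> and \<open>j\<close> are exchanged.\<close>
  define D where "D s = f (x + s *\<^sub>R axis i 1 + s *\<^sub>R axis j 1) - f (x + s *\<^sub>R axis i 1)
      - f (x + s *\<^sub>R axis j 1) + f x" for s
  have lim: "(\<lambda>n. D (1 / Suc n) / (1 / Suc n)\<^sup>2) \<longlonglongrightarrow> pd l (pd k f) x"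
    if eq: "\<And>s. D s = f (x + s *\<^sub>R axis k 1 + s *\<^sub>R axis l 1) - f (x + s *\<^sub>R axis k 1)
      - f (x + s *\<^sub>R axis l 1) + f x" for k l
  proof -
    have "\<exists>\<xi> \<eta>. 0 < \<xi> \<and> \<xi> < 1 / Suc n \<and> 0 < \<eta> \<and> \<eta> < 1 / Suc n \<and>
        D (1 / Suc n) / (1 / Suc n)\<^sup>2 = pd l (pd k f) (x + \<xi> *\<^sub>R axis k 1 + \<eta> *\<^sub>R axis l 1)" for n
    proof -
      have "0 < 1 / real (Suc n)" by simp
      from second_difference_eq_mixed_partial[OF f this] show ?thesis
        unfolding eq by (smt (verit) \<open>0 < 1 / real (Suc n)\<close> nonzero_mult_div_cancel_left zero_less_power)
    qed
    then obtain \<xi> \<eta> where *: "\<And>n. 0 < \<xi> n" "\<And>n. \<xi> n < 1 / Suc n" "\<And>n. 0 < \<eta> n" "\<And>n. \<eta> n < 1 / Suc n"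
      and D: "\<And>n. D (1 / Suc n) / (1 / Suc n)\<^sup>2 = pd l (pd k f) (x + \<xi> n *\<^sub>R axis k 1 + \<eta> n *\<^sub>R axis l 1)"
      by metis
    have z: "(\<lambda>n. 1 / real (Suc n)) \<longlonglongrightarrow> 0" using LIMSEQ_inverse_real_of_nat by (simp add: inverse_eq_divide)
    have "\<xi> \<longlonglongrightarrow> 0" "\<eta> \<longlonglongrightarrow> 0"
      by (rule tendsto_sandwich[OF always_eventually always_eventually tendsto_const z];
          use * less_imp_le in blast)+
    then have "(\<lambda>n. x + \<xi> n *\<^sub>R axis k 1 + \<eta> n *\<^sub>R axis l 1) \<longlonglongrightarrow> x + 0 *\<^sub>R axis k 1 + 0 *\<^sub>R axis l 1"
      by (intro tendsto_intros)
    moreover have "isCont (pd l (pd k f)) x"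
      using smooth_continuous[OF smooth_pd[OF smooth_pd[OF f]]] by (simp add: continuous_on_eq_continuous_at)
    ultimately show ?thesis
      unfolding D using isCont_tendsto_compose[of x "pd l (pd k f)"] by simp
  qed
  have "(\<lambda>n. D (1 / Suc n) / (1 / Suc n)\<^sup>2) \<longlonglongrightarrow> pd j (pd i f) x"
    by (rule lim) (simp add: D_def)
  moreover have "(\<lambda>n. D (1 / Suc n) / (1 / Suc n)\<^sup>2) \<longlonglongrightarrow> pd i (pd j f) x"
    by (rule lim) (simp add: D_def algebra_simps)
  ultimately show ?thesis using LIMSEQ_unique by blast
qed

section \<open>Integrals of partial derivatives of functions vanishing on the boundary\<close>

text \<open>Difference quotients of an integrable function on the whole space have integral zero. In the limit
this replaces the fundamental theorem of calculus and Fubini's theorem in the next lemma.\<close>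

lemma integral_shift_difference_zero:
  fixes F :: "'a::euclidean_space \<Rightarrow> real"
  assumes F: "integrable lborel F"
  shows "integrable lborel (\<lambda>x. F (x + a))" "integral\<^sup>L lborel (\<lambda>x. F (x + a) - F x) = 0"
proof -
  have "integrable (distr lborel borel ((+) a)) F" using F by (simp add: lborel_distr_plus)
  then have "integrable lborel (\<lambda>x. F (a + x))"
    by (subst (asm) integrable_distr_eq) (use F in auto)
  then show i: "integrable lborel (\<lambda>x. F (x + a))" by (simp add: add.commute)
  have "integral\<^sup>L lborel F = integral\<^sup>L (distr lborel borel ((+) a)) F" by (simp add: lborel_distr_plus)
  also have "\<dots> = integral\<^sup>L lborel (\<lambda>x. F (a + x))"
    by (subst integral_distr) (use F in auto)
  finally show "integral\<^sup>L lborel (\<lambda>x. F (x + a) - F x) = 0"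
    using F i by (simp add: add.commute)
qed

text \<open>Extended by zero outside \<open>K\<close>, the function \<open>f\<close> is Lipschitz along every line in direction \<open>j\<close>, because such a
line passes between \<open>K\<close> and its complement only at zeros of \<open>f\<close>. Hence the difference quotients are
bounded with bounded support. They converge to the partial derivative off the boundary of \<open>K\<close>, a null
set as \<open>K\<close> is convex, and dominated convergence applies.\<close>

lemma integral_pd_eq_0:
  fixes K :: "(real^2) set"
  assumes K: "compact K" "convex K"
    and f: "\<And>x. f differentiable (at x)" and cont: "continuous_on UNIV (pd j f)"
    and zero: "\<And>x. x \<in> frontier K \<Longrightarrow> f x = 0"
  shows "integral\<^sup>L lborel (\<lambda>x. indicator K x * pd j f x) = 0"
proof -
  define F where "F x = indicator K x * f x" for x
  let ?e = "axis j 1 :: real^2"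
  have cf: "continuous_on UNIV f"
    using f by (simp add: continuous_on_eq_continuous_at differentiable_imp_continuous_within)
  have [measurable]: "f \<in> borel_measurable borel" "pd j f \<in> borel_measurable borel" "K \<in> sets borel"
    using cf cont K by (auto simp: borel_measurable_continuous_onI compact_imp_closed)
  have closed: "closed K" using K compact_imp_closed by blast
  have "bounded (pd j f ` K)"
    using K cont by (meson compact_continuous_image compact_imp_bounded continuous_on_subset subset_UNIV)
  then obtain M where M: "M > 0" "\<And>x. x \<in> K \<Longrightarrow> \<bar>pd j f x\<bar> \<le> M"
    by (auto simp: bounded_pos)
  obtain R where R: "R > 0" "\<And>x. x \<in> K \<Longrightarrow> norm x \<le> R"
    using K compact_imp_bounded bounded_pos by metis
  have lip_in: "\<bar>f (x + s *\<^sub>R ?e) - f x\<bar> \<le> M * s" if "x \<in> K" "x + s *\<^sub>R ?e \<in> K" "0 \<le> s" for x s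
  proof (cases "s = 0")
    case False
    then obtain \<xi> where \<xi>: "0 < \<xi>" "\<xi> < s" "f (x + s *\<^sub>R ?e) - f x = s * pd j f (x + \<xi> *\<^sub>R ?e)"
      using MVT_along_axis[OF f, of s thesis for thesis] \<open>0 \<le> s\<close> by (metis less_eq_real_def)
    have "x + \<xi> *\<^sub>R ?e = (1 - \<xi>/s) *\<^sub>R x + (\<xi>/s) *\<^sub>R (x + s *\<^sub>R ?e)"
      using False by (simp add: algebra_simps)
    then have "x + \<xi> *\<^sub>R ?e \<in> K"
      using \<xi> that by (metis (no_types, lifting) K(2) convexD_alt divide_le_eq_1 dual_order.strict_trans less_imp_le zero_le_divide_iff)
    then show ?thesis using M(2) \<xi> that by (simp add: abs_mult mult.commute mult_right_mono)
  qed simp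
  have cross: "\<exists>r. 0 \<le> r \<and> r \<le> s \<and> x + r *\<^sub>R ?e \<in> frontier K"
    if "(x \<in> K) \<noteq> (x + s *\<^sub>R ?e \<in> K)" "0 \<le> s" for x s
  proof -
    let ?S = "closed_segment x (x + s *\<^sub>R ?e)"
    have "?S \<inter> frontier K \<noteq> {}"
      by (rule connected_Int_frontier) (use that in auto)
    then obtain z where z: "z \<in> ?S" "z \<in> frontier K" by blast
    then obtain u where "0 \<le> u" "u \<le> 1" "z = x + (u * s) *\<^sub>R ?e"
      by (auto simp: in_segment algebra_simps)
    then show ?thesis using z \<open>0 \<le> s\<close> by (intro exI[of _ "u * s"]) (auto simp: mult_left_le_one_le)
  qed
  have lip: "\<bar>F (x + s *\<^sub>R ?e) - F x\<bar> \<le> M * s" if s: "0 \<le> s" for x s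
  proof (cases "(x \<in> K) = (x + s *\<^sub>R ?e \<in> K)")
    case True
    then show ?thesis using lip_in[of x s] that M(1) by (cases "x \<in> K") (simp_all add: F_def)
  next
    case False
    obtain r where r: "0 \<le> r" "r \<le> s" "x + r *\<^sub>R ?e \<in> frontier K" using cross[OF False s] by blast
    define z where "z = x + r *\<^sub>R ?e"
    have z: "z \<in> K" "f z = 0" using r zero frontier_subset_closed[OF closed] by (auto simp: z_def)
    consider "x \<in> K" "x + s *\<^sub>R ?e \<notin> K" | "x \<notin> K" "x + s *\<^sub>R ?e \<in> K" using False by blast
    then show ?thesis
    proof cases
      case 1
      have "\<bar>f z - f x\<bar> \<le> M * r" using lip_in[of x r] 1 z r by (simp add: z_def)
      also have "\<dots> \<le> M * s" using M r by simp
      finally show ?thesis using 1 z by (simp add: F_def)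
    next
      case 2
      have eq: "z + (s - r) *\<^sub>R ?e = x + s *\<^sub>R ?e" by (simp add: z_def algebra_simps)
      have "\<bar>f (x + s *\<^sub>R ?e) - f z\<bar> \<le> M * (s - r)" using lip_in[of z "s - r"] 2 z r eq by simp
      also have "\<dots> \<le> M * s" using M r by simp
      finally show ?thesis using 2 z by (simp add: F_def)
    qed
  qed
  have Fint: "integrable lborel F"
  proof -
    have "integrable lborel (\<lambda>x. indicator K x *\<^sub>R f x)"
      by (rule borel_integrable_compact) (use K cf continuous_on_subset in auto)
    then show ?thesis by (simp add: F_def[abs_def])
  qed
  define S where "S n x = Suc n * (F (x + (1 / Suc n) *\<^sub>R ?e) - F x)" for n x
  have S0: "integral\<^sup>L lborel (S n) = 0" for n
    unfolding S_def by (simp add: integral_shift_difference_zero(2)[OF Fint])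
  have "(\<lambda>n. integral\<^sup>L lborel (S n)) \<longlonglongrightarrow> integral\<^sup>L lborel (\<lambda>x. indicator K x * pd j f x)"
  proof (rule integral_dominated_convergence)
    show "S n \<in> borel_measurable lborel" for n unfolding S_def F_def by measurable
    show "(\<lambda>x. indicator K x * pd j f x) \<in> borel_measurable lborel" by measurable
    show "integrable lborel (\<lambda>x. M * indicator (cball 0 (R + 1)) x)" 
      by (auto intro!: integrable_mult_right integrable_real_indicator emeasure_bounded_finite)
    show "AE x in lborel. norm (S n x) \<le> M * indicator (cball 0 (R + 1)) x" for n
    proof (intro always_eventually allI)
      fix x
      have n1: "norm ((1 / Suc n) *\<^sub>R ?e) \<le> 1" by simp
      show "norm (S n x) \<le> M * indicator (cball 0 (R + 1)) x"
      proof (cases "x \<in> cball 0 (R + 1)")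
        case True
        have "\<bar>F (x + (1 / Suc n) *\<^sub>R ?e) - F x\<bar> \<le> M * (1 / Suc n)" by (rule lip) simp
        then have "Suc n * \<bar>F (x + (1 / Suc n) *\<^sub>R ?e) - F x\<bar> \<le> Suc n * (M * (1 / Suc n))"
          by (intro mult_left_mono) auto
        then show ?thesis using True by (simp add: S_def abs_mult)
      next
        case False
        have "norm (x + (1 / Suc n) *\<^sub>R ?e) \<ge> norm x - norm ((1 / Suc n) *\<^sub>R ?e)"
          by (metis norm_diff_ineq)
        moreover have "R + 1 < norm x" using False by (simp add: not_le)
        ultimately have "R < norm (x + (1 / Suc n) *\<^sub>R ?e)" "R < norm x"
          using n1 by linarith+
        then have "x \<notin> K" "x + (1 / Suc n) *\<^sub>R ?e \<notin> K"
          using R(2) not_le by blast+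
        then show ?thesis using M by (simp add: S_def F_def)
      qed
    qed
    have "negligible (frontier K)" using K negligible_convex_frontier by blast
    then have "frontier K \<in> null_sets lborel"
      by (simp add: negligible_iff_null_sets null_sets_completion_iff)
    then have "AE x in lborel. x \<notin> frontier K" by (rule AE_not_in)
    moreover have "(\<lambda>n. S n x) \<longlonglongrightarrow> indicator K x * pd j f x" if x: "x \<notin> frontier K" for x
    proof -
      \<comment> \<open>An open set around \<open>x\<close> on which the extension by zero is either \<open>f\<close> or zero.\<close>
      define A where "A = (if x \<in> K then interior K else - K)"
      have A: "open A" "x \<in> A" using x closed closure_subset by (auto simp: A_def frontier_def)
      have z: "(\<lambda>n. 1 / real (Suc n)) \<longlonglongrightarrow> 0" using LIMSEQ_inverse_real_of_nat by (simp add: inverse_eq_divide)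
      have "(\<lambda>n. x + (1 / Suc n) *\<^sub>R ?e) \<longlonglongrightarrow> x + 0 *\<^sub>R ?e" by (intro tendsto_intros z)
      then have ev: "\<forall>\<^sub>F n in sequentially. x + (1 / Suc n) *\<^sub>R ?e \<in> A"
        using A topological_tendstoD[of "\<lambda>n. x + (1 / Suc n) *\<^sub>R ?e" "x"] by simp
      show ?thesis
      proof (cases "x \<in> K")
        case True
        have "((\<lambda>s. (f (x + s *\<^sub>R ?e) - f x) / s) \<longlongrightarrow> pd j f x) (at 0)"
          using DERIV_along_axis[OF f, of x j 0] by (simp add: DERIV_def)
        then have "(\<lambda>n. (f (x + (1 / Suc n) *\<^sub>R ?e) - f x) / (1 / Suc n)) \<longlonglongrightarrow> pd j f x"
          by (rule filterlim_compose) (use z in \<open>auto simp: filterlim_at\<close>)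
        moreover have "\<forall>\<^sub>F n in sequentially. (f (x + (1 / Suc n) *\<^sub>R ?e) - f x) / (1 / Suc n) = S n x"
          using ev by eventually_elim (use True interior_subset[of K] in \<open>auto simp: A_def S_def F_def\<close>)
        ultimately have "(\<lambda>n. S n x) \<longlonglongrightarrow> pd j f x" by (rule Lim_transform_eventually)
        then show ?thesis using x True by simp
      next
        case False
        have "\<forall>\<^sub>F n in sequentially. 0 = S n x"
          using ev by eventually_elim (use False in \<open>auto simp: A_def S_def F_def\<close>)
        then have "(\<lambda>n. S n x) \<longlonglongrightarrow> 0" by (rule Lim_transform_eventually[OF tendsto_const])
        then show ?thesis using x False by simp
      qed
    qed
    ultimately show "AE x in lborel. (\<lambda>n. S n x) \<longlonglongrightarrow> indicator K x * pd j f x"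
      by (auto elim: eventually_mono)
  qed
  then show ?thesis by (simp add: S0 LIMSEQ_const_iff)
qed

section \<open>The symmetric curl of a quadratic bubble and its edge traces\<close>

lemma affine_product_has_derivative:
  fixes g g' :: "'a::real_inner"
  shows "((\<lambda>x. (g \<bullet> x + c) * (g' \<bullet> x + c')) has_derivative
     (\<lambda>v. ((g' \<bullet> x + c') *\<^sub>R g + (g \<bullet> x + c) *\<^sub>R g') \<bullet> v)) (at x)"
  by (auto intro!: derivative_eq_intros simp: algebra_simps inner_add_left)

text \<open>The symmetric curl of \<open>t\<close> times a product of two affine functions, see \<open>sCurl_bubble\<close>. The explicit formula is
defined on the whole plane, linear in \<open>t\<close> and affine in \<open>x\<close>.\<close>

definition bubble_stress :: "real^2 \<Rightarrow> real^2 \<Rightarrow> real \<Rightarrow> real^2 \<Rightarrow> real \<Rightarrow> real^2 \<Rightarrow> real^2^2" where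
  "bubble_stress t g c g' c' x =
     symm (outer_product t (- rot90 ((g' \<bullet> x + c') *\<^sub>R g + (g \<bullet> x + c) *\<^sub>R g')))"

lemma sCurl_bubble:
  "sCurl (\<lambda>x. ((g \<bullet> x + c) * (g' \<bullet> x + c')) *\<^sub>R t) x = bubble_stress t g c g' c' x"
proof -
  let ?w = "(g' \<bullet> x + c') *\<^sub>R g + (g \<bullet> x + c) *\<^sub>R g'"
  have "pd j (\<lambda>y. ((g \<bullet> y + c) * (g' \<bullet> y + c')) * t $ i) x = ?w $ j * t $ i" for i j
  proof -
    have "((\<lambda>y. ((g \<bullet> y + c) * (g' \<bullet> y + c')) * t $ i) has_derivative (\<lambda>v. (?w \<bullet> v) * t $ i)) (at x)"
      by (intro has_derivative_mult_left affine_product_has_derivative)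
    from pd_has_derivative[OF this, of j] show ?thesis by (simp add: inner_axis)
  qed
  then have "Curl (\<lambda>x. ((g \<bullet> x + c) * (g' \<bullet> x + c')) *\<^sub>R t) x = outer_product t (- rot90 ?w)"
    by (simp add: Curl_def outer_product_def rot90_def vec_eq_iff forall_2 algebra_simps)
  then show ?thesis by (simp add: sCurl_def bubble_stress_def)
qed

lemma symm_sum_scaleR: "symm (\<Sum>e\<in>A. \<kappa> e *\<^sub>R Q e) = (\<Sum>e\<in>A. \<kappa> e *\<^sub>R symm (Q e))"
proof (induction A rule: infinite_finite_induct)
  case (insert x F)
  then show ?case by (simp add: symm_def vec_eq_iff transpose_def algebra_simps)
qed (simp_all add: symm_def vec_eq_iff transpose_def)

lemma sCurl_sum_scaleR:
  assumes "finite A" and d: "\<And>e i. e \<in> A \<Longrightarrow> (\<lambda>y. p e y $ i) differentiable (at x)"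
  shows "sCurl (\<lambda>y. \<Sum>e\<in>A. \<kappa> e *\<^sub>R p e y) x = (\<Sum>e\<in>A. \<kappa> e *\<^sub>R sCurl (p e) x)"
proof -
  have "pd j (\<lambda>y. (\<Sum>e\<in>A. \<kappa> e *\<^sub>R p e y) $ i) x = (\<Sum>e\<in>A. \<kappa> e * pd j (\<lambda>y. p e y $ i) x)" for i j
  proof -
    have "((\<lambda>y. \<Sum>e\<in>A. \<kappa> e * p e y $ i) has_derivative
        (\<lambda>v. \<Sum>e\<in>A. \<kappa> e * frechet_derivative (\<lambda>y. p e y $ i) (at x) v)) (at x)"
      using d frechet_derivative_works
      by (intro has_derivative_sum has_derivative_mult_right) blast
    then show ?thesis using pd_has_derivative by (simp add: pd_def frechet_derivative_at[symmetric] sum_component)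
  qed
  then have "Curl (\<lambda>y. \<Sum>e\<in>A. \<kappa> e *\<^sub>R p e y) x = (\<Sum>e\<in>A. \<kappa> e *\<^sub>R Curl (p e) x)"
    by (simp add: Curl_def vec_eq_iff forall_2 sum_component sum_negf)
  then show ?thesis by (simp add: sCurl_def symm_sum_scaleR)
qed

lemma norm_rot90 [simp]: "norm (rot90 v) = norm v"
  by (simp add: rot90_def norm_eq_sqrt_inner inner_vec_def sum_2)

lemma norm_symm_outer_product_le: "norm (symm (outer_product t v)) \<le> norm t * norm v"
proof -
  have "(norm (symm (outer_product t v)))\<^sup>2 + ((t$1 * v$2 - t$2 * v$1)\<^sup>2) / 2 = (norm t)\<^sup>2 * (norm v)\<^sup>2"
    unfolding power2_norm_eq_inner inner_vec_def sum_2 symm_def transpose_def outer_product_def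
    by (simp add: field_simps power2_eq_square)
  then have "(norm (symm (outer_product t v)))\<^sup>2 \<le> (norm t * norm v)\<^sup>2"
    by (simp add: power_mult_distrib) (smt (verit) zero_le_power2 divide_nonneg_nonneg)
  then show ?thesis by (rule power2_le_imp_le) simp
qed

lemma norm_bubble_stress_le:
  "norm (bubble_stress t g c g' c' x) \<le> norm t * (\<bar>g' \<bullet> x + c'\<bar> * norm g + \<bar>g \<bullet> x + c\<bar> * norm g')"
proof -
  have "norm (bubble_stress t g c g' c' x) \<le> norm t * norm ((g' \<bullet> x + c') *\<^sub>R g + (g \<bullet> x + c) *\<^sub>R g')"
    unfolding bubble_stress_def using norm_symm_outer_product_le by (metis norm_minus_cancel norm_rot90)
  also have "\<dots> \<le> norm t * (\<bar>g' \<bullet> x + c'\<bar> * norm g + \<bar>g \<bullet> x + c\<bar> * norm g')"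
    by (intro mult_left_mono) (auto intro: order_trans[OF norm_triangle_ineq])
  finally show ?thesis .
qed

lemma nn_symm_outer_product: "n \<bullet> (symm (outer_product t v) *v n) = (n \<bullet> t) * (n \<bullet> v)"
  by (simp add: inner_vec_def sum_2 symm_def transpose_def outer_product_def matrix_vector_mult_def)
    (simp add: field_simps)

lemma inner_rot90: "u \<bullet> rot90 v = - (rot90 u \<bullet> v)"
  by (simp add: inner_vec_def sum_2 rot90_def)

text \<open>Since \<open>rot90 n\<close> is minus the tangent, the right-hand side is \<open>- n \<bullet> \<partial>\<^sub>t p\<close> for \<open>p\<close> the bubble times \<open>t\<close>.\<close>

lemma nn_bubble_stress:
  "n \<bullet> (bubble_stress t g c g' c' x *v n)
     = (n \<bullet> t) * ((g' \<bullet> x + c') * (rot90 n \<bullet> g) + (g \<bullet> x + c) * (rot90 n \<bullet> g'))"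
  by (simp add: bubble_stress_def nn_symm_outer_product inner_rot90 inner_add_right)

lemma bubble_stress_has_derivative:
  "(bubble_stress t g c g' c' has_derivative
     (\<lambda>d. symm (outer_product t (- rot90 ((g' \<bullet> d) *\<^sub>R g + (g \<bullet> d) *\<^sub>R g'))))) (at x)"
proof -
  let ?L = "\<lambda>w. symm (outer_product t (- rot90 w))"
  have "linear ?L"
    by (rule linearI) (simp_all add: vec_eq_iff forall_2 symm_def transpose_def outer_product_def rot90_def field_simps)
  then have L: "bounded_linear ?L" by (simp add: linear_conv_bounded_linear)
  have "((\<lambda>x. (g' \<bullet> x + c') *\<^sub>R g + (g \<bullet> x + c) *\<^sub>R g') has_derivative (\<lambda>d. (g' \<bullet> d) *\<^sub>R g + (g \<bullet> d) *\<^sub>R g')) (at x)"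
    by (auto intro!: derivative_eq_intros)
  from bounded_linear.has_derivative[OF L this] show ?thesis
    by (simp add: bubble_stress_def[abs_def])
qed

text \<open>The number \<open>q\<^sub>n(N)\<close> at a point, as a linear functional of the derivative \<open>A\<close> of \<open>N\<close> at that point. Linearity splits
the trace of a sum of bubble stresses into the traces of its terms.\<close>

definition qn_form :: "real^2 \<Rightarrow> real^2 \<Rightarrow> (real^2 \<Rightarrow> real^2^2) \<Rightarrow> real" where
  "qn_form n t A = n \<bullet> (\<chi> i. \<Sum>j\<in>UNIV. A (axis j 1) $ i $ j) + n \<bullet> (A t *v t)"

lemma qn_form_derivative:
  assumes "(N has_derivative A) (at x)"
  shows "n \<bullet> row_div N x + dir_deriv t (\<lambda>y. n \<bullet> (N y *v t)) x = qn_form n t A"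
proof -
  have "((\<lambda>y. N y $ i $ j) has_derivative (\<lambda>d. A d $ i $ j)) (at x)" for i j
    using assms by (auto intro!: bounded_linear.has_derivative[OF bounded_linear_vec_nth])
  then have "pd j (\<lambda>y. N y $ i $ j) x = A (axis j 1) $ i $ j" for i j
    using pd_has_derivative by blast
  then have "row_div N x = (\<chi> i. \<Sum>j\<in>UNIV. A (axis j 1) $ i $ j)"
    by (simp add: row_div_def)
  moreover
  have "linear (\<lambda>M. n \<bullet> (M *v t))"
    by (rule linearI) (simp_all add: matrix_vector_mult_add_rdistrib inner_add_right scaleR_matrix_vector_assoc[symmetric])
  then have "bounded_linear (\<lambda>M. n \<bullet> (M *v t))" by (simp add: linear_conv_bounded_linear)
  from bounded_linear.has_derivative[OF this assms]
  have "dir_deriv t (\<lambda>y. n \<bullet> (N y *v t)) x = n \<bullet> (A t *v t)"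
    by (simp add: dir_deriv_def frechet_derivative_at[symmetric])
  ultimately show ?thesis by (simp add: qn_form_def)
qed

lemma qn_form_sum: "qn_form n t (\<lambda>d. \<Sum>e\<in>S. \<kappa> e *\<^sub>R A e d) = (\<Sum>e\<in>S. \<kappa> e * qn_form n t (A e))"
proof (induction S rule: infinite_finite_induct)
  case (insert x F)
  then show ?case
    by (simp add: qn_form_def inner_vec_def sum_2 matrix_vector_mult_def algebra_simps)
qed (simp_all add: qn_form_def inner_vec_def)

text \<open>The second derivative of the product of the affine functions in direction \<open>t\<close> is \<open>2 (g \<bullet> t) (g' \<bullet> t)\<close>, so
this is \<open>q\<^sub>n(sCurl p) = - \<partial>\<^sub>t\<^sub>t (p \<bullet> t)\<close> for \<open>p\<close> the bubble in direction \<open>t'\<close>. The rows of the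
curl are divergence free, so the divergence of the symmetrized curl is half the rotated gradient of \<open>div p\<close>. Writing \<open>div p\<close> in the
orthonormal frame \<open>(n, t)\<close>, its normal part cancels against \<open>\<partial>\<^sub>t\<close> of the \<open>nt\<close> component.\<close>

lemma qn_form_bubble:
  assumes n: "norm n = 1"
  defines "t \<equiv> - rot90 n"
  shows "qn_form n t (\<lambda>d. symm (outer_product t' (- rot90 ((g' \<bullet> d) *\<^sub>R g + (g \<bullet> d) *\<^sub>R g'))))
    = - 2 * (g \<bullet> t) * (g' \<bullet> t) * (t' \<bullet> t)"
proof -
  have n2: "n$1 * n$1 + n$2 * n$2 = 1"
    using n by (simp add: norm_eq_1 inner_vec_def sum_2)
  define A where "A d = symm (outer_product t' (- rot90 ((g' \<bullet> d) *\<^sub>R g + (g \<bullet> d) *\<^sub>R g')))" for d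
  have A: "A d $ i $ j = (t' $ i * (- rot90 ((g' \<bullet> d) *\<^sub>R g + (g \<bullet> d) *\<^sub>R g')) $ j
      + t' $ j * (- rot90 ((g' \<bullet> d) *\<^sub>R g + (g \<bullet> d) *\<^sub>R g')) $ i) / 2" for d i j
    by (simp add: A_def symm_def transpose_def outer_product_def)
  have t: "t $ 1 = n $ 2" "t $ 2 = - n $ 1" by (simp_all add: t_def rot90_def)
  \<comment> \<open>The factor \<open>\<parallel>n\<parallel>\<^sup>2 = 1\<close> makes the divergence term homogeneous of degree three in \<open>n\<close>, like the others.\<close>
  have "(n \<bullet> (\<chi> i. \<Sum>j\<in>UNIV. A (axis j 1) $ i $ j)) * (n$1 * n$1 + n$2 * n$2) + n \<bullet> (A t *v t)
      = - 2 * (g \<bullet> t) * (g' \<bullet> t) * (t' \<bullet> t)"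
    by (simp add: inner_vec_def sum_2 matrix_vector_mult_def A rot90_def axis_def t) (simp add: field_simps)
  then show ?thesis by (simp add: n2 qn_form_def A_def)
qed

lemma quad_sum:
  fixes n m :: "real^2" and Q :: "'e \<Rightarrow> real^2^2"
  shows "n \<bullet> ((\<Sum>e\<in>A. \<kappa> e *\<^sub>R Q e) *v m) = (\<Sum>e\<in>A. \<kappa> e * (n \<bullet> (Q e *v m)))"
  by (induction A rule: infinite_finite_induct)
    (simp_all add: inner_vec_def sum_2 matrix_vector_mult_def algebra_simps)

section \<open>Bubbles with vanishing distributional divdiv\<close>

text \<open>The symmetrization in \<open>sCurl\<close> is invisible to the Hessian of a test function.\<close>

lemma symm_inner:
  assumes "transpose H = H" shows "symm Q \<bullet> H = Q \<bullet> H"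
proof -
  have "transpose H $ 1 $ 2 = H $ 1 $ 2" using assms by simp
  then have "H $ 1 $ 2 = H $ 2 $ 1" by (simp add: transpose_def)
  then show ?thesis
    by (simp add: symm_def transpose_def inner_vec_def sum_2) (simp add: field_simps)
qed

lemma differentiable_affine_product:
  fixes g g' :: "'a::real_inner"
  shows "(\<lambda>x. (g \<bullet> x + c) * (g' \<bullet> x + c')) differentiable (at x)"
  unfolding differentiable_def using affine_product_has_derivative by blast

lemma pd_affine_product:
  "pd j (\<lambda>x. (g \<bullet> x + c) * (g' \<bullet> x + c')) x = (g' \<bullet> x + c') * g $ j + (g \<bullet> x + c) * g' $ j"
  using pd_has_derivative[OF affine_product_has_derivative] by (simp add: inner_axis)

lemma pd_mult:
  assumes "f differentiable (at x)" "u differentiable (at x)"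
  shows "pd j (\<lambda>x. f x * u x) x = f x * pd j u x + pd j f x * u x"
proof -
  have "(f has_derivative frechet_derivative f (at x)) (at x)" "(u has_derivative frechet_derivative u (at x)) (at x)"
    using assms frechet_derivative_works by blast+
  from pd_has_derivative[OF has_derivative_mult[OF this]] show ?thesis by (simp add: pd_def)
qed

lemma transpose_hessian:
  assumes "smooth \<phi>" shows "transpose (hessian \<phi> x) = hessian \<phi> x"
proof -
  have "transpose (hessian \<phi> x) $ i $ j = hessian \<phi> x $ i $ j" for i j
    unfolding transpose_def hessian_def using mixed_partials_commute[OF assms, of j i x] by simp
  then show ?thesis by (simp add: vec_eq_iff)
qed

lemma continuous_on_hessian: "smooth \<phi> \<Longrightarrow> continuous_on UNIV (hessian \<phi>)"
  unfolding hessian_def[abs_def] by (intro continuous_on_vec_lambda smooth_continuous smooth_pd)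

lemma continuous_on_bubble_stress: "continuous_on UNIV (bubble_stress t g c g' c')"
  using bubble_stress_has_derivative[of t g c g' c']
  by (intro has_derivative_continuous_on) (auto intro: has_derivative_at_withinI)

lemma integrable_indicator_compact:
  fixes f :: "'a::euclidean_space \<Rightarrow> 'b::euclidean_space"
  assumes "compact K" "continuous_on UNIV f"
  shows "integrable lborel (\<lambda>x. indicator K x *\<^sub>R f x)"
  by (rule borel_integrable_compact) (use assms continuous_on_subset in auto)

text \<open>The rows of an unsymmetrized curl are rotated gradients. Tested against the symmetric Hessian they give
\<open>\<Sum>\<^sub>i t\<^sub>i (\<partial>\<^sub>2 B \<partial>\<^sub>i \<partial>\<^sub>1 \<phi> - \<partial>\<^sub>1 B \<partial>\<^sub>i \<partial>\<^sub>2 \<phi>)\<close> for the bubble \<open>B\<close>. Adding \<open>B\<close> times third derivatives, which cancel, turns this into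
\<open>\<Sum>\<^sub>i t\<^sub>i (\<partial>\<^sub>2 (B \<partial>\<^sub>i \<partial>\<^sub>1 \<phi>) - \<partial>\<^sub>1 (B \<partial>\<^sub>i \<partial>\<^sub>2 \<phi>))\<close>, and each function that is differentiated here is zero on the
boundary of \<open>K\<close>.\<close>

lemma integral_bubble_stress_hessian:
  assumes K: "compact K" "convex K" and \<phi>: "smooth \<phi>"
    and zero: "\<And>x. x \<in> frontier K \<Longrightarrow> (g \<bullet> x + c) * (g' \<bullet> x + c') = 0 \<or> hessian \<phi> x = 0"
  shows "integral\<^sup>L lborel (\<lambda>x. indicator K x * (bubble_stress t g c g' c' x \<bullet> hessian \<phi> x)) = 0"
proof -
  define B where "B x = (g \<bullet> x + c) * (g' \<bullet> x + c')" for x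
  have B: "B differentiable (at x)" for x unfolding B_def by (rule differentiable_affine_product)
  have pdB: "pd j B x = (g' \<bullet> x + c') * g $ j + (g \<bullet> x + c) * g' $ j" for j x
    unfolding B_def by (rule pd_affine_product)
  note sm = smooth_pd[OF smooth_pd[OF \<phi>]]
  define F where "F i k x = B x * pd i (pd k \<phi>) x" for i k x
  have F: "F i k differentiable (at x)" for i k x
    unfolding F_def by (intro differentiable_mult B smooth_differentiable sm)
  have pdF: "pd j (F i k) x = B x * pd j (pd i (pd k \<phi>)) x + pd j B x * pd i (pd k \<phi>) x" for i j k x
    unfolding F_def by (intro pd_mult B smooth_differentiable sm)
  have cont: "continuous_on UNIV (pd j (F i k))" for i j k
  proof -
    have "continuous_on UNIV (\<lambda>x. B x * pd j (pd i (pd k \<phi>)) x + pd j B x * pd i (pd k \<phi>) x)"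
      unfolding pdB B_def by (intro continuous_intros smooth_continuous smooth_pd \<phi>)
    then show ?thesis by (simp add: pdF)
  qed
  have int0: "integral\<^sup>L lborel (\<lambda>x. indicator K x * pd j (F i k) x) = 0" for i j k
  proof (rule integral_pd_eq_0[OF K F cont])
    fix x assume "x \<in> frontier K"
    then have "B x = 0 \<or> hessian \<phi> x = 0" using zero by (simp add: B_def)
    then show "F i k x = 0" by (auto simp: F_def hessian_def vec_eq_iff)
  qed
  have int: "integrable lborel (\<lambda>x. indicator K x * pd j (F i k) x)" for i j k
    using integrable_indicator_compact[OF K(1) cont] by simp
  have third: "pd 2 (pd i (pd 1 \<phi>)) x = pd 1 (pd i (pd 2 \<phi>)) x" for i x
  proof -
    have "pd 2 (pd i (pd 1 \<phi>)) x = pd i (pd 2 (pd 1 \<phi>)) x"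
      by (rule mixed_partials_commute[OF smooth_pd[OF \<phi>]])
    also have "pd 2 (pd 1 \<phi>) = pd 1 (pd 2 \<phi>)" using mixed_partials_commute[OF \<phi>] by blast
    also have "pd i (pd 1 (pd 2 \<phi>)) x = pd 1 (pd i (pd 2 \<phi>)) x"
      by (rule mixed_partials_commute[OF smooth_pd[OF \<phi>]])
    finally show ?thesis .
  qed
  have "bubble_stress t g c g' c' x \<bullet> hessian \<phi> x = (\<Sum>i\<in>UNIV. t $ i * (pd 2 (F i 1) x - pd 1 (F i 2) x))" for x
  proof -
    have "bubble_stress t g c g' c' x \<bullet> hessian \<phi> x
        = outer_product t (- rot90 ((g' \<bullet> x + c') *\<^sub>R g + (g \<bullet> x + c) *\<^sub>R g')) \<bullet> hessian \<phi> x"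
      unfolding bubble_stress_def by (rule symm_inner[OF transpose_hessian[OF \<phi>]])
    also have "\<dots> = (\<Sum>i\<in>UNIV. t $ i * (pd 2 B x * pd i (pd 1 \<phi>) x - pd 1 B x * pd i (pd 2 \<phi>) x))"
      by (simp add: pdB inner_vec_def sum_2 outer_product_def hessian_def rot90_def algebra_simps)
    also have "\<dots> = (\<Sum>i\<in>UNIV. t $ i * (pd 2 (F i 1) x - pd 1 (F i 2) x))"
      by (simp add: pdF third)
    finally show ?thesis .
  qed
  then have "integral\<^sup>L lborel (\<lambda>x. indicator K x * (bubble_stress t g c g' c' x \<bullet> hessian \<phi> x))
     = integral\<^sup>L lborel (\<lambda>x. \<Sum>i\<in>UNIV. t $ i * (indicator K x * pd 2 (F i 1) x - indicator K x * pd 1 (F i 2) x))"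
    by (intro Bochner_Integration.integral_cong) (simp_all add: sum_distrib_left algebra_simps)
  also have "\<dots> = 0"
    using int by (simp add: int0)
  finally show ?thesis .
qed

lemma test_function_smooth: "test_function D \<phi> \<Longrightarrow> smooth \<phi>"
  by (simp add: test_function_def smooth_def)

lemma hessian_outside_support:
  assumes "x \<notin> closure {x. \<phi> x \<noteq> 0}" shows "hessian \<phi> x = 0"
proof -
  let ?U = "- closure {x. \<phi> x \<noteq> 0}"
  have z: "\<phi> y = 0" if "y \<in> ?U" for y using that closure_subset by force
  have const: "pd j (\<lambda>_. 0) y = 0" for j y
    using pd_has_derivative[OF has_derivative_const] .
  have 1: "pd j \<phi> y = 0" if "y \<in> ?U" for j y
  proof -
    have "\<forall>\<^sub>F y in nhds y. \<phi> y = 0"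
      by (rule eventually_mono[OF eventually_nhds_in_open[of ?U y] z]) (use that in auto)
    from pd_cong_nhds[OF this] show ?thesis by (simp add: const)
  qed
  have "pd i (pd j \<phi>) x = 0" for i j
  proof -
    have "\<forall>\<^sub>F y in nhds x. pd j \<phi> y = 0"
      by (rule eventually_mono[OF eventually_nhds_in_open[of ?U x] 1]) (use assms in auto)
    from pd_cong_nhds[OF this] show ?thesis by (simp add: const)
  qed
  then show ?thesis by (simp add: hessian_def vec_eq_iff)
qed

section \<open>Element polynomials\<close>

lemma Pk_1_affine: "(\<lambda>x. g \<bullet> x + c) \<in> Pk 1"
proof -
  define C where "C i j = (if i = 0 \<and> j = 0 then c else if i = 0 then g$2 else g$1)" for i j :: nat
  have "(\<lambda>x. g \<bullet> x + c) = (\<lambda>x. \<Sum>i\<le>1. \<Sum>j\<le>1 - i. C i j * (x$1)^i * (x$2)^j)"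
    by (simp add: fun_eq_iff C_def inner_vec_def sum_2)
  then show ?thesis unfolding Pk_def by blast
qed

lemma Pk_const: "(\<lambda>x. c) \<in> Pk k"
proof -
  define C where "C i j = (if i = 0 \<and> j = 0 then c else 0)" for i j :: nat
  have "(\<Sum>i\<le>k. \<Sum>j\<le>k - i. C i j * y^i * z^j) = c" for y z :: real
  proof -
    have "(\<Sum>i\<le>k. \<Sum>j\<le>k - i. C i j * y^i * z^j) = (\<Sum>i\<le>k. if i = 0 then c else 0)"
    proof (rule sum.cong)
      fix i
      have "(\<Sum>j\<le>k - i. C i j * y^i * z^j) = (\<Sum>j\<le>k - i. if j = 0 then (if i = 0 then c else 0) else 0)"
        by (rule sum.cong) (auto simp: C_def)
      then show "(\<Sum>j\<le>k - i. C i j * y^i * z^j) = (if i = 0 then c else 0)" by simp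
    qed simp
    then show ?thesis by simp
  qed
  then show ?thesis unfolding Pk_def by (intro CollectI exI[of _ C]) simp
qed

text \<open>The constant vectors \<open>t\<close> belong to \<open>RT 0\<close> and the rotated gradients of the quadratic bubbles to \<open>RT 1\<close>.\<close>

lemma sum_bubble_stress_in_X_elem:
  assumes "finite A"
  shows "(\<lambda>x. \<Sum>e\<in>A. \<kappa> e *\<^sub>R bubble_stress (t e) (g e) (c e) (g' e) (c' e) x) \<in> X_elem"
proof -
  define w where "w e x = - rot90 ((g' e \<bullet> x + c' e) *\<^sub>R g e + (g e \<bullet> x + c e) *\<^sub>R g' e)" for e x
  have t: "(\<lambda>_. t e) \<in> RT 0" for e
  proof -
    show ?thesis unfolding RT_def
      by (intro CollectI exI[of _ "\<lambda>_. t e"] exI[of _ "\<lambda>_. 0"]) (simp add: Pk_const)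
  qed
  have w: "w e \<in> RT 1" for e
  proof -
    have "(\<lambda>x. w e x $ i) \<in> Pk 1" for i
    proof -
      define h where "h = (if i = 1 then (g e)$2 *\<^sub>R g' e + (g' e)$2 *\<^sub>R g e else - ((g e)$1 *\<^sub>R g' e + (g' e)$1 *\<^sub>R g e))"
      define k where "k = (if i = 1 then (g e)$2 * c' e + (g' e)$2 * c e else - ((g e)$1 * c' e + (g' e)$1 * c e))"
      have "(\<lambda>x. w e x $ i) = (\<lambda>x. h \<bullet> x + k)"
        using exhaust_2[of i] by (auto simp: fun_eq_iff w_def h_def k_def rot90_def inner_add_left algebra_simps)
      then show ?thesis using Pk_1_affine by simp
    qed
    then show ?thesis unfolding RT_def
      by (intro CollectI exI[of _ "w e"] exI[of _ "\<lambda>_. 0"]) (simp add: Pk_const)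
  qed
  obtain f where f: "bij_betw f {..<card A} A"
    using ex_bij_betw_nat_finite[OF assms] by (auto simp: atLeast0LessThan)
  let ?Q = "\<lambda>x. \<Sum>k<card A. \<kappa> (f k) *\<^sub>R outer_product (t (f k)) (w (f k) x)"
  have "?Q \<in> tensor_space (RT 0) (RT 1)"
    unfolding tensor_space_def
    by (rule CollectI, rule exI[of _ "card A"], rule exI[of _ "\<lambda>k. \<kappa> (f k)"],
        rule exI[of _ "\<lambda>k _. t (f k)"], rule exI[of _ "\<lambda>k. w (f k)"]) (use t w in simp)
  moreover have "(\<Sum>e\<in>A. \<kappa> e *\<^sub>R bubble_stress (t e) (g e) (c e) (g' e) (c' e) x) = symm (?Q x)" for x
  proof -
    have "?Q x = (\<Sum>e\<in>A. \<kappa> e *\<^sub>R outer_product (t e) (w e x))"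
      by (rule sum.reindex_bij_betw[OF f])
    then show ?thesis by (simp add: symm_sum_scaleR bubble_stress_def w_def)
  qed
  ultimately show ?thesis unfolding X_elem_def by auto
qed

lemma real_polynomial_function_nth: "real_polynomial_function (\<lambda>x::real^2. x $ i)"
  by (rule real_polynomial_function.intros(1)[OF bounded_linear_vec_nth])

lemma real_polynomial_function_Pk: "f \<in> Pk k \<Longrightarrow> real_polynomial_function f"
  unfolding Pk_def by (auto intro!: real_polynomial_function_sum real_polynomial_function.intros(2-4)
      real_polynomial_function_power real_polynomial_function_nth)

lemma real_polynomial_function_RT:
  assumes "v \<in> RT k" shows "real_polynomial_function (\<lambda>x. v x $ i)"
proof -
  obtain u q where "\<And>i. (\<lambda>x. u x $ i) \<in> Pk k" "q \<in> Pk k" and v: "v = (\<lambda>x. u x + q x *\<^sub>R x)"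
    using assms unfolding RT_def by blast
  then have "real_polynomial_function (\<lambda>x. u x $ i + q x * x $ i)"
    by (intro real_polynomial_function.intros(3-4) real_polynomial_function_Pk real_polynomial_function_nth)
  then show ?thesis by (simp add: v)
qed

lemma real_polynomial_function_X_elem:
  assumes "P \<in> X_elem" shows "real_polynomial_function (\<lambda>x. P x $ i $ j)"
proof -
  obtain m :: nat and c \<phi> \<psi> where \<phi>: "\<And>k. k < m \<Longrightarrow> \<phi> k \<in> RT 0 \<and> \<psi> k \<in> RT 1"
    and P: "P = (\<lambda>x. symm (\<Sum>k<m. c k *\<^sub>R outer_product (\<phi> k x) (\<psi> k x)))"
    using assms unfolding X_elem_def tensor_space_def by auto
  have "(\<lambda>x. P x $ i $ j) = (\<lambda>x. \<Sum>k<m. c k * ((1/2) * (\<phi> k x $ i * \<psi> k x $ j + \<phi> k x $ j * \<psi> k x $ i)))"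
    unfolding P symm_sum_scaleR by (simp add: sum_component symm_def transpose_def outer_product_def)
  moreover have "real_polynomial_function (\<lambda>x. \<Sum>k<m. c k * ((1/2) * (\<phi> k x $ i * \<psi> k x $ j + \<phi> k x $ j * \<psi> k x $ i)))"
    by (intro real_polynomial_function_sum real_polynomial_function.intros(2-4))
       (use \<phi> real_polynomial_function_RT in auto)
  ultimately show ?thesis by simp
qed

text \<open>Restricted to a line through a point of \<open>U\<close>, the polynomial has infinitely many roots.\<close>

lemma real_polynomial_function_zero_on_open:
  fixes d :: "'a::euclidean_space \<Rightarrow> real"
  assumes d: "real_polynomial_function d" and U: "open U" "x0 \<in> U" "\<And>x. x \<in> U \<Longrightarrow> d x = 0"
  shows "d y = 0"
proof -
  define l where "l s = x0 + s *\<^sub>R (y - x0)" for s :: real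
  have "polynomial_function l" unfolding l_def
    by (intro polynomial_function_add polynomial_function_const polynomial_function_mult)
       (auto simp: polynomial_function_def)
  then have "real_polynomial_function (d \<circ> l)" using d by (rule real_polynomial_function_compose)
  then obtain a n where an: "d \<circ> l = (\<lambda>s. \<Sum>i\<le>n. a i * s^i)" by (auto simp: real_polynomial_function_iff_sum)
  have "open (l -` U)" unfolding l_def by (intro open_vimage U continuous_intros)
  moreover have "0 \<in> l -` U" using U by (simp add: l_def)
  ultimately have "infinite (l -` U)" using finite_imp_not_open by blast
  moreover have "l -` U \<subseteq> {s. (\<Sum>i\<le>n. a i * s^i) = 0}"
  proof
    fix s assume "s \<in> l -` U"
    then have "(d \<circ> l) s = 0" using U(3) by simp
    then show "s \<in> {s. (\<Sum>i\<le>n. a i * s^i) = 0}" by (simp only: an mem_Collect_eq)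
  qed
  ultimately have "infinite {s. (\<Sum>i\<le>n. a i * s^i) = 0}" using finite_subset by blast
  then have "\<forall>i\<le>n. a i = 0" using polyfun_finite_roots by blast
  then have "(d \<circ> l) 1 = 0" by (simp add: an)
  then show ?thesis by (simp add: l_def)
qed

text \<open>This justifies the definite description in \<^const>\<open>elem_part\<close>. The points of \<open>interior K\<close> at which an entry of \<open>P - Q\<close>
is nonzero form an open null set, which must be empty.\<close>

lemma X_elem_AE_unique:
  assumes P: "P \<in> X_elem" "Q \<in> X_elem" and K: "compact K" "interior K \<noteq> {}"
    and ae: "AE x in lebesgue_on K. P x = Q x"
  shows "P = Q"
proof -
  have "P y $ i $ j = Q y $ i $ j" for y i j
  proof -
    define d where "d x = P x $ i $ j - Q x $ i $ j" for x
    have d: "real_polynomial_function d"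
      unfolding d_def by (intro real_polynomial_function_diff real_polynomial_function_X_elem P)
    have "AE x in lebesgue. x \<in> K \<longrightarrow> P x = Q x"
      using ae K by (subst (asm) AE_restrict_space_iff) (auto simp: lmeasurable_compact fmeasurableD)
    then have "AE x in lebesgue. x \<notin> {x \<in> interior K. d x \<noteq> 0}"
      by (rule eventually_mono) (use interior_subset in \<open>auto simp: d_def\<close>)
    moreover have "open {x \<in> interior K. d x \<noteq> 0}"
    proof -
      have "continuous_on UNIV d"
        using d by (simp add: continuous_at_imp_continuous_on continuous_real_polymonial_function)
      then have "open (interior K \<inter> d -` (- {0}))" by (intro open_Int open_vimage) auto
      moreover have "{x \<in> interior K. d x \<noteq> 0} = interior K \<inter> d -` (- {0})" by auto
      ultimately show ?thesis by simp
    qed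
    ultimately have "{x \<in> interior K. d x \<noteq> 0} = {}"
      using open_not_negligible AE_iff_null_sets[of "{x \<in> interior K. d x \<noteq> 0}" lebesgue]
      by (auto simp: negligible_iff_null_sets)
    then show ?thesis
      using real_polynomial_function_zero_on_open[OF d open_interior[of K]] K(2) by (auto simp: d_def)
  qed
  then show ?thesis by (simp add: fun_eq_iff vec_eq_iff)
qed

section \<open>Barycentric coordinates on a triangle\<close>

lemma rot90_inner_self [simp]: "rot90 u \<bullet> u = 0" "u \<bullet> rot90 u = 0"
  by (simp_all add: rot90_def inner_vec_def sum_2)

text \<open>The vertices are ordered: facts are stated for the vertex \<open>a\<close> or the edge \<open>[a,b]\<close>, and the facts for the other
vertices and edges follow by permuting the parameters.\<close>

locale triangle =
  fixes a b c :: "real^2"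
  assumes indep: "\<not> affine_dependent {a, b, c}" and distinct: "a \<noteq> b" "a \<noteq> c" "b \<noteq> c"
begin

abbreviation K :: "(real^2) set" where "K \<equiv> convex hull {a, b, c}"

lemma vertices_K: "vertices K = {a, b, c}"
  using extreme_point_of_convex_hull_affine_independent[OF indep] by (auto simp: vertices_def)

lemma affine_combination:
  obtains u v w where "x = u *\<^sub>R a + v *\<^sub>R b + w *\<^sub>R c" "u + v + w = 1"
proof -
  have "card {a, b, c} = 3" using distinct by simp
  then have "affine hull {a, b, c} = UNIV"
    by (intro affine_independent_span_eq indep) simp
  then have "x \<in> affine hull {a, b, c}" by simp
  then show ?thesis using that unfolding affine_hull_3 by blast
qed

text \<open>An affine function is determined by its values at the vertices.\<close>

lemma affine_function_zero:
  assumes "g \<bullet> a + k = 0" "g \<bullet> b + k = 0" "g \<bullet> c + k = 0"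
  shows "g = 0" "k = 0"
proof -
  have *: "g \<bullet> x + k = 0" for x
  proof -
    obtain u v w where x: "x = u *\<^sub>R a + v *\<^sub>R b + w *\<^sub>R c" and uvw: "u + v + w = 1"
      by (rule affine_combination)
    have "k = (u + v + w) * k" using uvw by simp
    then have "g \<bullet> x + k = u * (g \<bullet> a + k) + v * (g \<bullet> b + k) + w * (g \<bullet> c + k)"
      unfolding x by (simp add: inner_add_right algebra_simps)
    then show ?thesis using assms by simp
  qed
  show "k = 0" using *[of 0] by simp
  then show "g = 0" using *[of g] by simp
qed

text \<open>The coordinate of \<open>a\<close> is an affine function whose gradient is normal to \<open>[b,c]\<close>, scaled to the value one at
\<open>a\<close>. The scaling is possible because otherwise a nonzero affine function would be zero at all vertices.\<close>

lemma bary_a: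
  "\<exists>g k. bary K a = (\<lambda>x. g \<bullet> x + k)" "bary K a a = 1" "bary K a b = 0" "bary K a c = 0"
proof -
  define w where "w = rot90 (b - c)"
  define d where "d = w \<bullet> a - w \<bullet> b"
  have wc: "w \<bullet> c = w \<bullet> b"
    using rot90_inner_self(1)[of "b - c"] by (simp add: w_def inner_diff_right)
  have "d \<noteq> 0"
  proof
    assume "d = 0"
    then have "w = 0" using affine_function_zero(1)[of w "- (w \<bullet> b)"] wc by (simp add: d_def)
    then have "norm (b - c) = 0" by (metis norm_rot90 norm_zero w_def)
    then show False using distinct by simp
  qed
  let ?l = "\<lambda>x. ((1/d) *\<^sub>R w) \<bullet> x + - (w \<bullet> b) / d"
  let ?P = "\<lambda>l. (\<exists>g k. l = (\<lambda>x. g \<bullet> x + k)) \<and> l a = 1 \<and> (\<forall>w \<in> vertices K - {a}. l w = (0::real))"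
  have vert: "vertices K - {a} = {b, c}" using distinct vertices_K by auto
  have l: "?l x = (w \<bullet> x - w \<bullet> b) / d" for x by (simp add: diff_divide_distrib)
  have "?l a = 1" "?l b = 0" "?l c = 0" unfolding l using \<open>d \<noteq> 0\<close> wc by (simp_all flip: d_def)
  then have P: "?P ?l" unfolding vert by blast
  \<comment> \<open>Two candidates differ by an affine function that is zero at all vertices.\<close>
  have uniq: "l = l'" if l: "?P l" and l': "?P l'" for l l'
  proof -
    obtain g k g' k' where eq: "l = (\<lambda>x. g \<bullet> x + k)" "l' = (\<lambda>x. g' \<bullet> x + k')" using l l' by auto
    have "g - g' = 0" "k - k' = 0"
      using affine_function_zero[of "g - g'" "k - k'"] l l' unfolding vert
      by (auto simp: eq inner_diff_left)
    then show ?thesis by (simp add: eq)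
  qed
  have "?P (bary K a)" unfolding bary_def
    by (rule theI[of ?P ?l]) (use P uniq in blast)+
  then show "\<exists>g k. bary K a = (\<lambda>x. g \<bullet> x + k)" "bary K a a = 1" "bary K a b = 0" "bary K a c = 0"
    unfolding vert by blast+
qed

lemma rotate: "triangle b c a" and rotate': "triangle c a b" and swap: "triangle b a c"
  using indep distinct by (auto simp: triangle_def insert_commute)

lemma K_rotate: "convex hull {b, c, a} = K" and K_rotate': "convex hull {c, a, b} = K"
  and K_swap: "convex hull {b, a, c} = K"
  by (simp_all add: insert_commute)

lemma bary_affine:
  assumes "z \<in> {a, b, c}"
  obtains g k where "bary K z = (\<lambda>x. g \<bullet> x + k)"
  using assms bary_a(1) triangle.bary_a(1)[OF rotate] triangle.bary_a(1)[OF rotate']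
  unfolding K_rotate K_rotate' by blast

lemma bary_values [simp]:
  "bary K a a = 1" "bary K a b = 0" "bary K a c = 0"
  "bary K b b = 1" "bary K b a = 0" "bary K b c = 0"
  "bary K c c = 1" "bary K c a = 0" "bary K c b = 0"
  using bary_a triangle.bary_a[OF rotate] triangle.bary_a[OF rotate'] unfolding K_rotate K_rotate' by auto

lemma affine_eq_combination:
  assumes "l = (\<lambda>x. g \<bullet> x + (k::real))" "u + v + w = 1"
  shows "l (u *\<^sub>R a + v *\<^sub>R b + w *\<^sub>R c) = u * l a + v * l b + w * l c"
proof -
  have "k = (u + v + w) * k" using assms by simp
  then show ?thesis unfolding assms(1) by (simp add: inner_add_right algebra_simps)
qed

lemma bary_combination:
  assumes "u + v + w = 1"
  shows "bary K a (u *\<^sub>R a + v *\<^sub>R b + w *\<^sub>R c) = u"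
    "bary K b (u *\<^sub>R a + v *\<^sub>R b + w *\<^sub>R c) = v"
    "bary K c (u *\<^sub>R a + v *\<^sub>R b + w *\<^sub>R c) = w"
proof -
  obtain g k where "bary K a = (\<lambda>x. g \<bullet> x + k)" by (rule bary_affine[of a]) simp
  from affine_eq_combination[OF this assms] show "bary K a (u *\<^sub>R a + v *\<^sub>R b + w *\<^sub>R c) = u" by simp
  obtain g k where "bary K b = (\<lambda>x. g \<bullet> x + k)" by (rule bary_affine[of b]) simp
  from affine_eq_combination[OF this assms] show "bary K b (u *\<^sub>R a + v *\<^sub>R b + w *\<^sub>R c) = v" by simp
  obtain g k where "bary K c = (\<lambda>x. g \<bullet> x + k)" by (rule bary_affine[of c]) simp
  from affine_eq_combination[OF this assms] show "bary K c (u *\<^sub>R a + v *\<^sub>R b + w *\<^sub>R c) = w" by simp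
qed

lemma bary_sum: "bary K a x + bary K b x + bary K c x = 1"
  and bary_point: "bary K a x *\<^sub>R a + bary K b x *\<^sub>R b + bary K c x *\<^sub>R c = x"
proof -
  obtain u v w where x: "x = u *\<^sub>R a + v *\<^sub>R b + w *\<^sub>R c" and uvw: "u + v + w = 1"
    by (rule affine_combination)
  show "bary K a x + bary K b x + bary K c x = 1"
    using bary_combination[OF uvw] uvw unfolding x by simp
  show "bary K a x *\<^sub>R a + bary K b x *\<^sub>R b + bary K c x *\<^sub>R c = x"
    using bary_combination[OF uvw] unfolding x by simp
qed

lemma affine_interpolation:
  assumes "l = (\<lambda>x. g \<bullet> x + (k::real))"
  shows "l x = bary K a x * l a + bary K b x * l b + bary K c x * l c"
  using affine_eq_combination[OF assms bary_sum[of x]] by (simp add: bary_point)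

lemma mem_K_iff: "x \<in> K \<longleftrightarrow> 0 \<le> bary K a x \<and> 0 \<le> bary K b x \<and> 0 \<le> bary K c x"
proof
  assume "x \<in> K"
  then obtain u v w where "0 \<le> u" "0 \<le> v" "0 \<le> w" "u + v + w = 1" "x = u *\<^sub>R a + v *\<^sub>R b + w *\<^sub>R c"
    unfolding convex_hull_3 by blast
  then show "0 \<le> bary K a x \<and> 0 \<le> bary K b x \<and> 0 \<le> bary K c x" using bary_combination by simp
next
  \<comment> \<open>Named because the coordinates contain the convex hull that is unfolded below.\<close>
  define u v w where "u = bary K a x" "v = bary K b x" "w = bary K c x"
  assume "0 \<le> bary K a x \<and> 0 \<le> bary K b x \<and> 0 \<le> bary K c x"
  then have "0 \<le> u \<and> 0 \<le> v \<and> 0 \<le> w" "u + v + w = 1" "x = u *\<^sub>R a + v *\<^sub>R b + w *\<^sub>R c"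
    using bary_sum[of x] bary_point[of x] by (simp_all add: u_v_w_def)
  then show "x \<in> K" unfolding convex_hull_3 by blast
qed

lemma continuous_bary: assumes "z \<in> {a, b, c}" shows "continuous_on UNIV (bary K z)"
proof -
  obtain g k where l: "bary K z = (\<lambda>x. g \<bullet> x + k)" using bary_affine[OF assms] by blast
  show ?thesis unfolding l by (intro continuous_intros)
qed

lemma open_bary_pos: assumes "z \<in> {a, b, c}" shows "open {x. 0 < bary K z x}"
  using continuous_bary[OF assms] by (intro open_Collect_less continuous_intros)

lemma interior_K: assumes "0 < bary K a x" "0 < bary K b x" "0 < bary K c x" shows "x \<in> interior K"
proof (rule interiorI)
  show "open ({x. 0 < bary K a x} \<inter> {x. 0 < bary K b x} \<inter> {x. 0 < bary K c x})"
    by (intro open_Int open_bary_pos) auto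
qed (use assms in \<open>auto simp: mem_K_iff\<close>)

lemma interior_K_nonempty: "interior K \<noteq> {}"
proof -
  have "(1/3) *\<^sub>R a + (1/3) *\<^sub>R b + (1/3) *\<^sub>R c \<in> interior K"
    by (intro interior_K) (simp_all add: bary_combination)
  then show ?thesis by blast
qed

lemma compact_K: "compact K"
  by (simp add: finite_imp_compact_convex_hull)

lemma frontier_K:
  assumes "x \<in> frontier K"
  shows "x \<in> K" "bary K a x = 0 \<or> bary K b x = 0 \<or> bary K c x = 0"
proof -
  show "x \<in> K" using assms frontier_subset_closed[OF compact_imp_closed[OF compact_K]] by blast
  moreover have "x \<notin> interior K" using assms by (simp add: frontier_def)
  ultimately show "bary K a x = 0 \<or> bary K b x = 0 \<or> bary K c x = 0"
    using interior_K[of x] unfolding mem_K_iff by (metis less_eq_real_def)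
qed

lemma segment_ab_iff: "x \<in> closed_segment a b \<longleftrightarrow> x \<in> K \<and> bary K c x = 0"
proof
  assume "x \<in> closed_segment a b"
  then obtain u where u: "0 \<le> u" "u \<le> 1" and x: "x = (1 - u) *\<^sub>R a + u *\<^sub>R b + 0 *\<^sub>R c"
    by (auto simp: in_segment)
  have "bary K a x = 1 - u" "bary K b x = u" "bary K c x = 0"
    unfolding x by (rule bary_combination, simp)+
  then show "x \<in> K \<and> bary K c x = 0" using u mem_K_iff by simp
next
  assume x: "x \<in> K \<and> bary K c x = 0"
  then have "bary K a x = 1 - bary K b x" "bary K b x \<le> 1" "0 \<le> bary K b x"
    using bary_sum[of x] unfolding mem_K_iff by auto
  moreover from this have "x = (1 - bary K b x) *\<^sub>R a + bary K b x *\<^sub>R b"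
    using bary_point[of x] x by simp
  ultimately show "x \<in> closed_segment a b" unfolding in_segment by blast
qed

text \<open>Near the midpoint of \<open>[a,b]\<close>, membership in the triangle is decided by the sign of the third coordinate.\<close>

lemma half_disc_at_midpoint:
  obtains \<delta> where "\<delta> > 0" "\<And>y. y \<in> ball (midpoint a b) \<delta> \<Longrightarrow> 0 < bary K a y \<and> 0 < bary K b y"
proof -
  let ?U = "{x. 0 < bary K a x} \<inter> {x. 0 < bary K b x}"
  have m: "midpoint a b = (1/2) *\<^sub>R a + (1/2) *\<^sub>R b + 0 *\<^sub>R c"
    by (simp add: midpoint_def scaleR_right_distrib)
  have mid: "bary K a (midpoint a b) = 1/2" "bary K b (midpoint a b) = 1/2"
    unfolding m by (rule bary_combination, simp)+
  have "open ?U" by (intro open_Int open_bary_pos) auto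
  moreover have "midpoint a b \<in> ?U" using mid by simp
  ultimately obtain \<delta> where "\<delta> > 0" "ball (midpoint a b) \<delta> \<subseteq> ?U" using open_contains_ball by metis
  then show ?thesis using that by blast
qed

lemma bary_le_1: assumes "x \<in> K" "z \<in> {a, b, c}" shows "0 \<le> bary K z x" "bary K z x \<le> 1"
  using assms bary_sum[of x] unfolding mem_K_iff by auto

lemma vertices_ab: "vertices (closed_segment a b) = {a, b}"
  by (auto simp: vertices_def extreme_point_of_segment)

lemma prod_vertices_ab: "(\<Prod>z\<in>vertices (closed_segment a b). f z) = f a * f b"
  using distinct by (simp add: vertices_ab)

lemma edge_of_cases:
  assumes "e edge_of K"
  shows "e = closed_segment a b \<or> e = closed_segment b c \<or> e = closed_segment c a"
proof -
  have e: "e face_of K" "aff_dim e = 1" using assms by (auto simp: edge_of_def)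
  then obtain s where s: "s \<subseteq> {a, b, c}" "e = convex hull s"
    using face_of_convex_hull_affine_independent[OF indep] by blast
  have "\<not> affine_dependent s" using s(1) indep affine_dependent_subset by blast
  then have "int (card s) = aff_dim s + 1" by (rule aff_dim_affine_independent)
  then have "card s = 2" using e s by (simp add: aff_dim_convex_hull)
  then obtain x y where "s = {x, y}" "x \<noteq> y" by (auto simp: card_2_iff)
  then show ?thesis using s by (auto simp: segment_convex_hull insert_commute)
qed

end

lemma triangle_exists:
  assumes "2 simplex K" obtains a b c where "triangle a b c" "K = convex hull {a, b, c}"
proof -
  obtain C where C: "\<not> affine_dependent C" "card C = 3" "K = convex hull C"
    using assms by (auto simp: simplex_def)
  obtain a b c where "C = {a, b, c}" "a \<noteq> b" "a \<noteq> c" "b \<noteq> c" using C(2) card_3_iff by metis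
  then show ?thesis using that C by (simp add: triangle_def)
qed

lemma triangle_edge_exists:
  assumes "2 simplex K" "e edge_of K"
  obtains a b c where "triangle a b c" "K = convex hull {a, b, c}" "e = closed_segment a b"
proof -
  obtain a b c where t: "triangle a b c" "K = convex hull {a, b, c}" using triangle_exists[OF assms(1)] .
  interpret triangle a b c by (rule t)
  consider "e = closed_segment a b" | "e = closed_segment b c" | "e = closed_segment c a"
    using edge_of_cases assms(2) t(2) by blast
  then show ?thesis
    using that t rotate rotate' K_rotate K_rotate' by metis
qed

lemma triangle_of_segment_edge:
  assumes "2 simplex K" "closed_segment a b edge_of K"
  obtains c where "triangle a b c" "K = convex hull {a, b, c}"
proof -
  obtain a' b' c where t: "triangle a' b' c" "K = convex hull {a', b', c}" and e: "closed_segment a b = closed_segment a' b'"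
    using triangle_edge_exists[OF assms] by metis
  have "{a, b} = {a', b'}" using e closed_segment_eq by blast
  then consider "a = a'" "b = b'" | "a = b'" "b = a'" by (auto simp: doubleton_eq_iff)
  then show ?thesis using that t triangle.swap[OF t(1)] triangle.K_swap[OF t(1)] by metis
qed

lemma finite_edges:
  fixes K :: "(real^2) set"
  assumes "2 simplex K" shows "finite {e. e edge_of K}" "card {e. e edge_of K} \<le> 3"
proof -
  obtain a b c where t: "triangle a b c" "K = convex hull {a, b, c}" using triangle_exists[OF assms] .
  let ?S = "{closed_segment a b, closed_segment b c, closed_segment c a}"
  have sub: "{e. e edge_of K} \<subseteq> ?S" using triangle.edge_of_cases[OF t(1)] t(2) by blast
  then show "finite {e. e edge_of K}" using finite_subset by blast
  have "card {e. e edge_of K} \<le> card ?S" by (intro card_mono sub) auto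
  also have "\<dots> \<le> 3" by (simp add: card_insert_if)
  finally show "card {e. e edge_of K} \<le> 3" .
qed

section \<open>The element adjacent to a boundary edge\<close>

text \<open>Points slightly below the graph near \<open>x\<close> have a neighbourhood that does not meet the domain.\<close>

lemma lipschitz_domain_frontier_not_interior_closure:
  assumes D: "bounded_lipschitz_domain D" and xD: "x \<in> frontier D"
  shows "x \<notin> interior (closure D)"
proof
  assume "x \<in> interior (closure D)"
  then obtain s where s: "s > 0" "ball x s \<subseteq> closure D" by (auto simp: mem_interior)
  obtain r u g L where r: "r > 0" and u: "norm u = 1" and g: "L-lipschitz_on UNIV (g :: real \<Rightarrow> real)"
    and eq: "D \<inter> ball x r = {y \<in> ball x r. g (y \<bullet> rot90 u) < y \<bullet> u}"
    using D xD unfolding bounded_lipschitz_domain_def by blast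
  have "x \<notin> D" using D xD by (auto simp: bounded_lipschitz_domain_def frontier_def interior_open)
  then have "x \<notin> {y \<in> ball x r. g (y \<bullet> rot90 u) < y \<bullet> u}" using eq by blast
  then have gx: "x \<bullet> u \<le> g (x \<bullet> rot90 u)" using r by simp
  \<comment> \<open>Below the graph, as \<open>x\<close> lies on or below it.\<close>
  define y where "y = x - (min r s / 2) *\<^sub>R u"
  have y: "y \<in> ball x r" "y \<in> ball x s" using r s u by (auto simp: y_def dist_norm)
  have "y \<bullet> rot90 u = x \<bullet> rot90 u" by (simp add: y_def inner_diff_left)
  moreover have "y \<bullet> u = x \<bullet> u - min r s / 2"
    using u by (simp add: y_def inner_diff_left dot_square_norm)
  ultimately have yu: "y \<bullet> u < g (y \<bullet> rot90 u)" using gx r s by (simp add: min_def)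
  define U where "U = ball x r \<inter> {z. z \<bullet> u < g (z \<bullet> rot90 u)}"
  have "continuous_on UNIV g" using g by (rule lipschitz_on_continuous_on)
  then have "open U" unfolding U_def
    by (intro open_Int open_ball open_Collect_less continuous_intros)
       (auto intro!: continuous_intros continuous_on_compose2[of UNIV g])
  moreover have "U \<inter> D = {}"
  proof -
    have "z \<notin> D" if "z \<in> U" for z
    proof
      assume "z \<in> D"
      then have "z \<in> D \<inter> ball x r" using that by (simp add: U_def)
      then have "z \<in> {y \<in> ball x r. g (y \<bullet> rot90 u) < y \<bullet> u}" unfolding eq .
      then show False using that by (simp add: U_def)
    qed
    then show ?thesis by blast
  qed
  moreover have "y \<in> U" using y yu by (simp add: U_def)
  ultimately have "y \<notin> closure D" using open_Int_closure_eq_empty by blast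
  then show False using s y by blast
qed

text \<open>A proper face of \<open>K\<close> does not meet the interior of \<open>K\<close>, so the common face of \<open>K\<close> and \<open>K'\<close> is \<open>K\<close> itself; and \<open>K\<close> cannot be a
proper face of \<open>K'\<close>, because both have dimension two.\<close>

lemma triangulation_interior_disjoint:
  assumes T: "conforming_triangulation D T" and K: "K \<in> T" "K' \<in> T" "x \<in> interior K" "x \<in> K'"
  shows "K = K'"
proof -
  have simp: "2 simplex K" "2 simplex K'" and f: "(K \<inter> K') face_of K" "(K' \<inter> K) face_of K'"
    using T K unfolding conforming_triangulation_def triangulation_def by blast+
  have "x \<in> K \<inter> K'" using K interior_subset by blast
  then have "K \<inter> K' = K" using face_of_disjoint_interior[OF f(1)] K(3) by blast
  then have "K face_of K'" using f(2) by (simp add: Int_commute)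
  then show ?thesis
    using face_of_aff_dim_lt[of K' K] convex_simplex simp aff_dim_simplex by fastforce
qed

text \<open>The third coordinates of two triangles with the common edge \<open>[a,b]\<close> are both zero at \<open>a\<close> and \<open>b\<close>, hence proportional.
If the factor \<open>\<rho>\<close> is positive, both triangles lie on the same side of \<open>[a,b]\<close> and overlap, which is possible in a
triangulation only if they are equal. If it is negative, the triangles cover a disc about the midpoint of
\<open>[a,b]\<close>, although the midpoint is a boundary point of a Lipschitz domain.\<close>

lemma boundary_edge_elem_unique:
  assumes D: "bounded_lipschitz_domain D" and T: "conforming_triangulation D T"
    and e: "e \<subseteq> frontier D" and K: "K \<in> T" "K' \<in> T" "e edge_of K" "e edge_of K'"
  shows "K = K'"
proof -
  have simp: "2 simplex K" "2 simplex K'" and cover: "\<Union>T = closure D"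
    using T K unfolding conforming_triangulation_def by blast+
  obtain a b c where t: "triangle a b c" and Keq: "K = convex hull {a, b, c}" and ab: "e = closed_segment a b"
    using triangle_edge_exists[OF simp(1) K(3)] .
  obtain c' where t': "triangle a b c'" and Keq': "K' = convex hull {a, b, c'}"
    using triangle_of_segment_edge[OF simp(2)] K(4) ab by metis
  interpret K: triangle a b c by (rule t)
  interpret K': triangle a b c' by (rule t')
  let ?m = "midpoint a b"
  obtain \<delta> where \<delta>: "\<delta> > 0" "\<And>y. y \<in> ball ?m \<delta> \<Longrightarrow> 0 < bary K a y \<and> 0 < bary K b y"
    using K.half_disc_at_midpoint unfolding Keq by metis
  obtain \<delta>' where \<delta>': "\<delta>' > 0" "\<And>y. y \<in> ball ?m \<delta>' \<Longrightarrow> 0 < bary K' a y \<and> 0 < bary K' b y"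
    using K'.half_disc_at_midpoint unfolding Keq' by metis
  obtain g' k' where l': "bary K' c' = (\<lambda>x. g' \<bullet> x + k')"
    using K'.bary_affine[of c'] unfolding Keq' by auto
  define \<rho> where "\<rho> = bary K' c' c"
  have scale: "bary K' c' x = \<rho> * bary K c x" for x
    using K.affine_interpolation[OF l', of x] unfolding Keq[symmetric] \<rho>_def
    using K'.bary_values unfolding Keq'[symmetric] by simp
  have "\<rho> \<noteq> 0" using scale[of c'] K'.bary_values(7) unfolding Keq'[symmetric] by auto
  then consider "\<rho> > 0" | "\<rho> < 0" by linarith
  then show ?thesis
  proof cases
    case 1
    \<comment> \<open>A step from the midpoint towards \<open>c\<close> that stays in both discs.\<close>
    define r where "r = min \<delta> \<delta>' / (2 * norm (c - ?m) + 2)"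
    have n: "2 * norm (c - ?m) + 2 > 0" using norm_ge_zero[of "c - ?m"] by linarith
    have r: "r > 0" using \<delta> \<delta>' n by (simp add: r_def)
    define y where "y = ?m + r *\<^sub>R (c - ?m)"
    have "r * norm (c - ?m) < min \<delta> \<delta>'"
    proof -
      have "r * (2 * norm (c - ?m) + 2) = min \<delta> \<delta>'" using n by (simp add: r_def)
      then have "2 * (r * norm (c - ?m)) + 2 * r = min \<delta> \<delta>'" by (simp add: algebra_simps)
      moreover have "0 \<le> r * norm (c - ?m)" using r by simp
      ultimately show ?thesis using r by linarith
    qed
    then have y: "y \<in> ball ?m \<delta>" "y \<in> ball ?m \<delta>'" using r by (auto simp: y_def dist_norm)
    have "y = ((1 - r) / 2) *\<^sub>R a + ((1 - r) / 2) *\<^sub>R b + r *\<^sub>R c"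
      by (simp add: y_def midpoint_def vec_eq_iff field_simps)
    then have "bary K c y = r" using K.bary_combination(3)[of "(1-r)/2" "(1-r)/2" r] unfolding Keq by simp
    then have "y \<in> interior K" "y \<in> K'"
      using K.interior_K[of y] K'.mem_K_iff[of y] \<delta>(2)[OF y(1)] \<delta>'(2)[OF y(2)] scale[of y] 1 r
      unfolding Keq[symmetric] Keq'[symmetric] by (auto simp: less_imp_le)
    then show ?thesis using triangulation_interior_disjoint[OF T K(1,2)] by blast
  next
    case 2
    have "ball ?m (min \<delta> \<delta>') \<subseteq> closure D"
    proof
      fix y assume "y \<in> ball ?m (min \<delta> \<delta>')"
      then have y: "y \<in> ball ?m \<delta>" "y \<in> ball ?m \<delta>'" by auto
      have "y \<in> K \<or> y \<in> K'"
        using K.mem_K_iff[of y] K'.mem_K_iff[of y] \<delta>(2)[OF y(1)] \<delta>'(2)[OF y(2)] scale[of y] 2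
        unfolding Keq[symmetric] Keq'[symmetric] by (auto simp: less_imp_le mult_nonpos_nonpos)
      then show "y \<in> closure D" using K cover by blast
    qed
    then have "?m \<in> interior (closure D)" using \<delta> \<delta>' by (auto simp: mem_interior intro!: exI[of _ "min \<delta> \<delta>'"])
    moreover have "?m \<in> frontier D" using e ab midpoint_in_closed_segment by blast
    ultimately show ?thesis using lipschitz_domain_frontier_not_interior_closure[OF D] by blast
  qed
qed

lemma adj_elem_eq:
  assumes "bounded_lipschitz_domain D" "conforming_triangulation D T" "e \<subseteq> frontier D" "K \<in> T" "e edge_of K"
  shows "adj_elem T e = K"
  unfolding adj_elem_def
  by (rule the_equality) (use assms boundary_edge_elem_unique in blast)+

section \<open>Normals, tangents and barycentric gradients\<close>

text \<open>Along the diameter in the direction \<open>g\<close> of a disc of radius \<open>r\<close> contained in \<open>K\<close>, the function increases by \<open>2 r \<parallel>g\<parallel>\<close>.\<close>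

lemma gradient_inscribed_diameter_le:
  assumes "compact K" "K \<noteq> {}" and l: "\<And>x. x \<in> K \<Longrightarrow> 0 \<le> g \<bullet> x + k \<and> g \<bullet> x + k \<le> 1"
  shows "norm g * inscribed_diameter K \<le> 1"
proof (cases "g = 0")
  case False
  have "inscribed_diameter K \<le> 1 / norm g" unfolding inscribed_diameter_def
  proof (rule cSup_least)
    obtain x where "x \<in> K" using assms by blast
    then have "2 * 0 \<in> {2 * r |r x. 0 \<le> r \<and> cball x r \<subseteq> K}" by force
    then show "{2 * r |r x. 0 \<le> r \<and> cball x r \<subseteq> K} \<noteq> {}" by blast
    fix s assume "s \<in> {2 * r |r x. 0 \<le> r \<and> cball x r \<subseteq> K}"
    then obtain r x where s: "s = 2 * r" "0 \<le> r" "cball x r \<subseteq> K" by blast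
    have "x + r *\<^sub>R sgn g \<in> K" "x - r *\<^sub>R sgn g \<in> K"
      using s False by (auto intro!: subsetD[OF s(3)] simp: dist_norm norm_sgn)
    from l[OF this(1)] l[OF this(2)] have "2 * r * (g \<bullet> sgn g) \<le> 1"
      by (simp add: inner_add_right inner_diff_right)
    also have "g \<bullet> sgn g = norm g" using False by (simp add: sgn_div_norm dot_square_norm power2_eq_square)
    finally show "s \<le> 1 / norm g" using False s by (simp add: field_simps)
  qed
  then show ?thesis using False by (simp add: field_simps)
qed simp

lemma orthonormal_expansion:
  assumes "norm n = 1" shows "v = (v \<bullet> n) *\<^sub>R n + (v \<bullet> rot90 n) *\<^sub>R rot90 n"
proof -
  have n: "n$1 * n$1 + n$2 * n$2 = 1" using assms by (simp add: norm_eq_1 inner_vec_def sum_2)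
  have "v$1 = v$1 * (n$1 * n$1 + n$2 * n$2)" "v$2 = v$2 * (n$1 * n$1 + n$2 * n$2)" by (simp_all add: n)
  then show ?thesis
    by (simp add: vec_eq_iff forall_2 rot90_def inner_vec_def sum_2 algebra_simps)
qed

context triangle begin

text \<open>The coordinate of the vertex opposite to \<open>[a,b]\<close> is zero on \<open>[a,b]\<close> and nonnegative on \<open>K\<close>. For uniqueness, any
admissible \<open>n\<close> is the gradient of an affine function that is zero at \<open>a\<close> and \<open>b\<close>, thus a multiple of \<open>g\<close>; the norm
of \<open>n\<close> and the sign of \<open>n \<bullet> (c - a)\<close> fix the factor.\<close>

lemma outward_normal_eq:
  assumes adj: "adj_elem T (closed_segment a b) = K" and l: "bary K c = (\<lambda>x. g \<bullet> x + k)"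
  shows "outward_normal T (closed_segment a b) = - sgn g" "g \<noteq> 0"
proof -
  have lv: "g \<bullet> a + k = 0" "g \<bullet> b + k = 0" "g \<bullet> c + k = 1" using bary_values(7-9) unfolding l by auto
  then show g0: "g \<noteq> 0" by auto
  have seg: "g \<bullet> x + k = 0" "x \<in> K" if "x \<in> closed_segment a b" for x
    using that segment_ab_iff l by auto
  show "outward_normal T (closed_segment a b) = - sgn g" unfolding outward_normal_def adj
  proof (rule the_equality, intro conjI ballI)
    show "norm (- sgn g) = 1" using g0 by (simp add: norm_sgn)
    show "- sgn g \<bullet> (y - x) = 0" if "x \<in> closed_segment a b" "y \<in> closed_segment a b" for x y
      using seg[OF that(1)] seg[OF that(2)] by (simp add: sgn_div_norm inner_diff_right)
    show "- sgn g \<bullet> (y - x) \<le> 0" if "x \<in> closed_segment a b" "y \<in> K" for x y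
    proof -
      have "0 \<le> g \<bullet> (y - x)" using seg[OF that(1)] that(2) mem_K_iff l by (simp add: inner_diff_right)
      then show ?thesis by (simp add: sgn_div_norm)
    qed
  next
    fix n assume n: "norm n = 1 \<and> (\<forall>x\<in>closed_segment a b. \<forall>y\<in>closed_segment a b. n \<bullet> (y - x) = 0) \<and>
      (\<forall>x\<in>closed_segment a b. \<forall>y\<in>K. n \<bullet> (y - x) \<le> 0)"
    define s where "s = n \<bullet> (c - a)"
    have "c \<in> K" by (simp add: hull_inc)
    then have s: "s \<le> 0" "n \<bullet> (b - a) = 0" using n by (auto simp: s_def)
    have *: "(n - s *\<^sub>R g) \<bullet> x + (- (n \<bullet> a) - s * k) = n \<bullet> (x - a) - s * (g \<bullet> x + k)" for x
      by (simp add: inner_diff_left inner_diff_right algebra_simps)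
    have "n - s *\<^sub>R g = 0"
      by (rule affine_function_zero(1)[of _ "- (n \<bullet> a) - s * k"]; unfold * lv)
         (use s in \<open>simp_all add: s_def\<close>)
    then have ns: "n = s *\<^sub>R g" by simp
    then have "norm n = - s * norm g" using s by simp
    then have "s = - (1 / norm g)" using n g0 by (simp add: field_simps)
    then show "n = - sgn g" unfolding ns by (simp add: sgn_div_norm divide_inverse)
  qed
qed

text \<open>These are the data of the edge that enter the trace formulas. The last equation holds since \<open>b - a\<close> is \<open>\<plusminus>|b - a| t\<close>,
and \<open>\<lambda>\<^sub>a\<close> decreases from one to zero from \<open>a\<close> to \<open>b\<close>, while \<open>\<lambda>\<^sub>b\<close> increases from zero to one.\<close>

lemma edge_frame:
  assumes adj: "adj_elem T (closed_segment a b) = K"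
    and la: "bary K a = (\<lambda>x. ga \<bullet> x + ka)" and lb: "bary K b = (\<lambda>x. gb \<bullet> x + kb)"
    and lc: "bary K c = (\<lambda>x. gc \<bullet> x + kc)"
  defines "n \<equiv> outward_normal T (closed_segment a b)" and "t \<equiv> tangent T (closed_segment a b)"
  shows "norm n = 1" "norm t = 1" "t = - rot90 n" "n \<bullet> t = 0" "gc \<bullet> t = 0"
    "(ga \<bullet> t) * (gb \<bullet> t) * (dist a b)\<^sup>2 = -1"
proof -
  have gc: "n = - sgn gc" "gc \<noteq> 0" unfolding n_def using outward_normal_eq[OF adj lc] by auto
  show n: "norm n = 1" using gc by (simp add: norm_sgn)
  show t: "t = - rot90 n" by (simp add: t_def n_def tangent_def)
  show "norm t = 1" using n by (simp add: t)
  show "n \<bullet> t = 0" by (simp add: t)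
  then show gct: "gc \<bullet> t = 0" using gc by (simp add: sgn_div_norm)
  have "gc \<bullet> (b - a) = 0" using bary_values(8,9) unfolding lc by (simp add: inner_diff_right)
  then have "n \<bullet> (b - a) = 0" unfolding gc by (simp add: sgn_div_norm)
  then have ba: "b - a = ((b - a) \<bullet> t) *\<^sub>R t"
    using orthonormal_expansion[OF n, of "b - a"] by (simp add: t inner_commute)
  define s where "s = (b - a) \<bullet> t"
  have "norm (b - a) = \<bar>s\<bar>" using ba \<open>norm t = 1\<close> unfolding s_def by (metis mult.right_neutral norm_scaleR)
  then have s2: "(dist a b)\<^sup>2 = s * s" by (simp add: dist_norm norm_minus_commute power2_eq_square)
  have "ga \<bullet> (b - a) = -1" "gb \<bullet> (b - a) = 1"
    using bary_values(1-5) unfolding la lb by (auto simp: inner_diff_right)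
  then have "s * (ga \<bullet> t) = -1" "s * (gb \<bullet> t) = 1"
    using ba unfolding s_def by (metis inner_scaleR_right)+
  then have "(s * (ga \<bullet> t)) * (s * (gb \<bullet> t)) = -1" by simp
  then show "(ga \<bullet> t) * (gb \<bullet> t) * (dist a b)\<^sup>2 = -1" unfolding s2 by (simp add: algebra_simps)
qed

end

lemma diameter_closed_segment:
  fixes a b :: "'a::euclidean_space"
  shows "diameter (closed_segment a b) = dist a b"
proof (rule antisym)
  show "diameter (closed_segment a b) \<le> dist a b"
  proof (rule diameter_le)
    fix x y assume "x \<in> closed_segment a b" "y \<in> closed_segment a b"
    then obtain u v where u: "0 \<le> u" "u \<le> 1" "0 \<le> v" "v \<le> 1"
      and xy: "x = (1 - u) *\<^sub>R a + u *\<^sub>R b" "y = (1 - v) *\<^sub>R a + v *\<^sub>R b" by (auto simp: in_segment)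
    have "x - y = (u - v) *\<^sub>R (b - a)" by (simp add: xy algebra_simps)
    then have "norm (x - y) = \<bar>u - v\<bar> * dist a b" by (simp add: dist_norm norm_minus_commute)
    also have "\<dots> \<le> 1 * dist a b" using u by (intro mult_right_mono) auto
    finally show "norm (x - y) \<le> dist a b" by simp
  qed simp
  show "dist a b \<le> diameter (closed_segment a b)"
    by (rule diameter_bounded_bound) (auto simp: compact_imp_bounded)
qed

text \<open>The parametrization chosen in \<^const>\<open>edge_integral\<close> may be reversed, but its endpoints have the same distance.\<close>

lemma edge_integral_const:
  assumes "e = closed_segment a b" and f: "\<And>x. x \<in> e \<Longrightarrow> f x = q"
  shows "edge_integral e f = diameter e * q"
proof -
  obtain a' b' where ab: "(SOME (a, b). e = closed_segment a b) = (a', b')" by fastforce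
  have "case (SOME (a, b). e = closed_segment a b) of (a, b) \<Rightarrow> e = closed_segment a b"
    by (rule someI[of _ "(a, b)"]) (simp add: assms)
  then have e: "e = closed_segment a' b'" by (simp add: ab)
  have "integral {0..1} (\<lambda>s. f ((1 - s) *\<^sub>R a' + s *\<^sub>R b')) = integral {0..1} (\<lambda>s::real. q)"
    by (rule Henstock_Kurzweil_Integration.integral_cong) (rule f, auto simp: e in_segment)
  then have "edge_integral e f = dist a' b' * q" unfolding edge_integral_def ab by simp
  then show ?thesis by (simp add: e diameter_closed_segment)
qed

lemma content_cball_plane: "r \<ge> 0 \<Longrightarrow> measure lborel (cball (c::real^2) r) = pi * r\<^sup>2"
  by (simp add: content_cball unit_ball_vol_2)

section \<open>Symmetric curls of combinations of boundary bubbles\<close>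

text \<open>A single mesh of the family.\<close>

locale lipschitz_mesh =
  fixes D :: "(real^2) set" and T :: "(real^2) set set"
  assumes domain: "bounded_lipschitz_domain D" and mesh: "conforming_triangulation D T"
begin

abbreviation "E \<equiv> bd_edges D T"

text \<open>The contribution of one edge, without weight. The bubble is replaced by the polynomial that it equals on its
element, so that derivatives at points of the edge itself make sense.\<close>

definition edge_stress :: "(real^2) set \<Rightarrow> real^2 \<Rightarrow> real^2^2" where
  "edge_stress e = sCurl (\<lambda>x. (\<Prod>z\<in>vertices e. bary (adj_elem T e) z x) *\<^sub>R tangent T e)"

text \<open>The field \<open>p\<close> for arbitrary weights; the correction field has the weights \<open>w e = h\<^sub>e \<mu>\<^sub>e / 2\<close>.\<close>

definition bubble_field :: "((real^2) set \<Rightarrow> real) \<Rightarrow> real^2 \<Rightarrow> real^2" where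
  "bubble_field w x = (\<Sum>e\<in>E. w e *\<^sub>R (edge_bubble T e x *\<^sub>R tangent T e))"

text \<open>The polynomial that represents \<open>sCurl (bubble_field w)\<close> on \<open>K\<close>.\<close>

definition local_stress :: "((real^2) set \<Rightarrow> real) \<Rightarrow> (real^2) set \<Rightarrow> real^2 \<Rightarrow> real^2^2" where
  "local_stress w K x = (\<Sum>e\<in>{e \<in> E. adj_elem T e = K}. w e *\<^sub>R edge_stress e x)"

lemma finite_T: "finite T" and simplex_T: "K \<in> T \<Longrightarrow> 2 simplex K"
  using mesh unfolding conforming_triangulation_def triangulation_def by blast+

lemma finite_E: "finite E"
proof (rule finite_subset)
  show "E \<subseteq> (\<Union>K\<in>T. {e. e edge_of K})" by (auto simp: bd_edges_def)
  show "finite (\<Union>K\<in>T. {e. e edge_of K})" using finite_T finite_edges(1)[OF simplex_T] by blast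
qed

lemma E_adj:
  assumes "e \<in> E"
  shows "adj_elem T e \<in> T" "e edge_of adj_elem T e" "e \<subseteq> frontier D" "2 simplex adj_elem T e"
    "compact (adj_elem T e)" "convex (adj_elem T e)"
proof -
  obtain K where K: "K \<in> T" "e edge_of K" and e: "e \<subseteq> frontier D" using assms by (auto simp: bd_edges_def)
  have "adj_elem T e = K" by (rule adj_elem_eq[OF domain mesh e K])
  then show "adj_elem T e \<in> T" "e edge_of adj_elem T e" "e \<subseteq> frontier D" "2 simplex adj_elem T e"
    "compact (adj_elem T e)" "convex (adj_elem T e)"
    using K e simplex_T compact_simplex convex_simplex by blast+
qed

lemma E_triangle:
  assumes "e \<in> E"
  obtains a b c where "triangle a b c" "adj_elem T e = convex hull {a, b, c}" "e = closed_segment a b"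
  using triangle_edge_exists[OF E_adj(4)[OF assms] E_adj(2)[OF assms]] .

lemma edge_stress_eq:
  assumes "triangle a b c" "adj_elem T e = convex hull {a, b, c}" "e = closed_segment a b"
    and "bary (adj_elem T e) a = (\<lambda>x. g \<bullet> x + k)" "bary (adj_elem T e) b = (\<lambda>x. g' \<bullet> x + k')"
  shows "edge_stress e = bubble_stress (tangent T e) g k g' k'"
proof -
  interpret triangle a b c by (rule assms)
  have "(\<Prod>z\<in>vertices e. bary (adj_elem T e) z x) = (g \<bullet> x + k) * (g' \<bullet> x + k')" for x
    using prod_vertices_ab[of "\<lambda>z. bary (adj_elem T e) z x"] assms by simp
  then show ?thesis unfolding edge_stress_def by (simp add: sCurl_bubble fun_eq_iff)
qed

lemma E_stress:
  assumes "e \<in> E"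
  obtains ga ka gb kb where
    "(\<lambda>x. \<Prod>z\<in>vertices e. bary (adj_elem T e) z x) = (\<lambda>x. (ga \<bullet> x + ka) * (gb \<bullet> x + kb))"
    "edge_stress e = bubble_stress (tangent T e) ga ka gb kb"
proof -
  obtain a b c where t: "triangle a b c" "adj_elem T e = convex hull {a, b, c}" "e = closed_segment a b"
    using E_triangle[OF assms] .
  interpret triangle a b c by (rule t)
  obtain ga ka where a: "bary K a = (\<lambda>x. ga \<bullet> x + ka)" by (rule bary_affine[of a]) simp
  obtain gb kb where b: "bary K b = (\<lambda>x. gb \<bullet> x + kb)" by (rule bary_affine[of b]) simp
  have "(\<Prod>z\<in>vertices e. bary (adj_elem T e) z x) = (ga \<bullet> x + ka) * (gb \<bullet> x + kb)" for x
    using prod_vertices_ab[of "\<lambda>z. bary (adj_elem T e) z x"] t a b by simp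
  then show ?thesis
    using that a b edge_stress_eq[OF t] unfolding t(2) by simp
qed

lemma edge_stress_has_derivative:
  assumes "e \<in> E"
  shows "(edge_stress e has_derivative frechet_derivative (edge_stress e) (at x)) (at x)"
proof -
  obtain ga ka gb kb where "(\<lambda>x. \<Prod>z\<in>vertices e. bary (adj_elem T e) z x) = (\<lambda>x. (ga \<bullet> x + ka) * (gb \<bullet> x + kb))"
    and S: "edge_stress e = bubble_stress (tangent T e) ga ka gb kb"
    using E_stress[OF assms] .
  have "edge_stress e differentiable (at x)"
    unfolding S differentiable_def using bubble_stress_has_derivative by blast
  then show ?thesis using frechet_derivative_works by blast
qed

lemma continuous_edge_stress:
  assumes "e \<in> E" shows "continuous_on UNIV (edge_stress e)"
proof -
  obtain ga ka gb kb where "(\<lambda>x. \<Prod>z\<in>vertices e. bary (adj_elem T e) z x) = (\<lambda>x. (ga \<bullet> x + ka) * (gb \<bullet> x + kb))"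
    and S: "edge_stress e = bubble_stress (tangent T e) ga ka gb kb"
    using E_stress[OF assms] .
  show ?thesis unfolding S by (rule continuous_on_bubble_stress)
qed

lemma same_elem:
  assumes "K \<in> T" "x \<in> interior K" "e \<in> E" shows "x \<in> adj_elem T e \<longleftrightarrow> adj_elem T e = K"
  using triangulation_interior_disjoint[OF mesh assms(1) E_adj(1)[OF assms(3)] assms(2)] assms(2) interior_subset
  by blast

text \<open>Away from the edges, each bubble coincides in a neighbourhood with a polynomial or with zero.\<close>

lemma sCurl_bubble_field:
  assumes x: "x \<notin> \<Union>(frontier ` T)"
  shows "sCurl (bubble_field w) x = (\<Sum>e\<in>E. w e *\<^sub>R (indicator (adj_elem T e) x *\<^sub>R edge_stress e x))"
proof -
  let ?A = "{e \<in> E. x \<in> adj_elem T e}"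
  let ?P = "\<lambda>e x. (\<Prod>z\<in>vertices e. bary (adj_elem T e) z x) *\<^sub>R tangent T e"
  have "\<forall>\<^sub>F y in nhds x. edge_bubble T e y *\<^sub>R tangent T e = (if x \<in> adj_elem T e then ?P e y else 0)" if e: "e \<in> E" for e
  proof (cases "x \<in> adj_elem T e")
    case True
    then have "x \<in> interior (adj_elem T e)"
      using x E_adj(1)[OF e] closure_subset[of "adj_elem T e"] by (auto simp: frontier_def)
    then have "\<forall>\<^sub>F y in nhds x. y \<in> interior (adj_elem T e)" by (simp add: eventually_nhds_in_open)
    then show ?thesis
      by (rule eventually_mono) (use True interior_subset[of "adj_elem T e"] in \<open>auto simp: edge_bubble_def\<close>)
  next
    case False
    have "\<forall>\<^sub>F y in nhds x. y \<in> - adj_elem T e"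
      using False compact_imp_closed[OF E_adj(5)[OF e]] by (intro eventually_nhds_in_open) auto
    then show ?thesis
      by (rule eventually_mono) (use False in \<open>auto simp: edge_bubble_def\<close>)
  qed
  then have "\<forall>\<^sub>F y in nhds x. \<forall>e\<in>E. edge_bubble T e y *\<^sub>R tangent T e = (if x \<in> adj_elem T e then ?P e y else 0)"
    by (intro eventually_ball_finite finite_E) blast
  then have "\<forall>\<^sub>F y in nhds x. bubble_field w y = (\<Sum>e\<in>?A. w e *\<^sub>R ?P e y)"
  proof (rule eventually_mono)
    fix y assume *: "\<forall>e\<in>E. edge_bubble T e y *\<^sub>R tangent T e = (if x \<in> adj_elem T e then ?P e y else 0)"
    have "bubble_field w y = (\<Sum>e\<in>E. if x \<in> adj_elem T e then w e *\<^sub>R ?P e y else 0)"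
      unfolding bubble_field_def by (rule sum.cong) (use * in auto)
    then show "bubble_field w y = (\<Sum>e\<in>?A. w e *\<^sub>R ?P e y)"
      by (simp add: sum.inter_filter[OF finite_E] del: scaleR_scaleR)
  qed
  then have "sCurl (bubble_field w) x = sCurl (\<lambda>y. \<Sum>e\<in>?A. w e *\<^sub>R ?P e y) x" by (rule sCurl_cong_nhds)
  also have "\<dots> = (\<Sum>e\<in>?A. w e *\<^sub>R edge_stress e x)"
    unfolding edge_stress_def
  proof (rule sCurl_sum_scaleR)
    show "finite ?A" using finite_E by simp
    fix e i assume "e \<in> ?A"
    then have e: "e \<in> E" by simp
    obtain ga ka gb kb where P: "(\<lambda>x. \<Prod>z\<in>vertices e. bary (adj_elem T e) z x) = (\<lambda>x. (ga \<bullet> x + ka) * (gb \<bullet> x + kb))"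
      and "edge_stress e = bubble_stress (tangent T e) ga ka gb kb" using E_stress[OF e] .
    have "(\<lambda>y. ((ga \<bullet> y + ka) * (gb \<bullet> y + kb)) * tangent T e $ i) differentiable (at x)"
      by (intro differentiable_mult differentiable_affine_product differentiable_const)
    then show "(\<lambda>y. ?P e y $ i) differentiable (at x)" using fun_cong[OF P] by simp
  qed
  also have "\<dots> = (\<Sum>e\<in>E. if x \<in> adj_elem T e then w e *\<^sub>R edge_stress e x else 0)"
    by (simp add: sum.inter_filter[OF finite_E])
  also have "\<dots> = (\<Sum>e\<in>E. w e *\<^sub>R (indicator (adj_elem T e) x *\<^sub>R edge_stress e x))"
    by (rule sum.cong) auto
  finally show ?thesis .
qed

lemma AE_off_frontiers: "AE x in lebesgue. x \<notin> \<Union>(frontier ` T)"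
proof -
  have "negligible (\<Union>(frontier ` T))"
    using finite_T negligible_convex_frontier convex_simplex simplex_T by (intro negligible_Union) auto
  then show ?thesis by (intro AE_not_in) (simp add: negligible_iff_null_sets)
qed

lemma sCurl_bubble_field_local:
  assumes "K \<in> T" "x \<in> K" "x \<notin> \<Union>(frontier ` T)"
  shows "sCurl (bubble_field w) x = local_stress w K x"
proof -
  have "x \<in> interior K" using assms closure_subset[of K] by (auto simp: frontier_def)
  then have "sCurl (bubble_field w) x = (\<Sum>e\<in>E. if adj_elem T e = K then w e *\<^sub>R edge_stress e x else 0)"
    unfolding sCurl_bubble_field[OF assms(3)]
    by (intro sum.cong) (use same_elem[OF assms(1)] in \<open>auto simp: indicator_def\<close>)
  also have "\<dots> = local_stress w K x"
    by (simp add: local_stress_def sum.inter_filter[OF finite_E])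
  finally show ?thesis .
qed

lemma lebesgue_sets_T: "K \<in> T \<Longrightarrow> K \<in> sets lebesgue"
  using compact_simplex simplex_T lmeasurable_compact fmeasurableD by blast

lemma AE_sCurl_bubble_field_local:
  assumes "K \<in> T" shows "AE x in lebesgue_on K. sCurl (bubble_field w) x = local_stress w K x"
  using AE_off_frontiers lebesgue_sets_T[OF assms]
  by (subst AE_restrict_space_iff) (auto elim!: eventually_mono simp: sCurl_bubble_field_local[OF assms])

lemma local_stress_in_X_elem: "local_stress w K \<in> X_elem"
proof -
  \<comment> \<open>All coefficients of one edge are packed into the single value \<open>q\<close>, so that a choice function can select them together.\<close>
  have "\<forall>e\<in>E. \<exists>q. edge_stress e = bubble_stress (tangent T e) (fst (fst q)) (snd (fst q)) (fst (snd q)) (snd (snd q))"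
  proof
    fix e assume e: "e \<in> E"
    obtain ga ka gb kb where "(\<lambda>x. \<Prod>z\<in>vertices e. bary (adj_elem T e) z x) = (\<lambda>x. (ga \<bullet> x + ka) * (gb \<bullet> x + kb))"
      and "edge_stress e = bubble_stress (tangent T e) ga ka gb kb" using E_stress[OF e] .
    then show "\<exists>q. edge_stress e = bubble_stress (tangent T e) (fst (fst q)) (snd (fst q)) (fst (snd q)) (snd (snd q))"
      by (intro exI[of _ "((ga, ka), (gb, kb))"]) simp
  qed
  then obtain q where "\<And>e. e \<in> E \<Longrightarrow> edge_stress e
      = bubble_stress (tangent T e) (fst (fst (q e))) (snd (fst (q e))) (fst (snd (q e))) (snd (snd (q e)))"
    by metis
  then have "local_stress w K = (\<lambda>x. \<Sum>e\<in>{e \<in> E. adj_elem T e = K}. w e *\<^sub>R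
      bubble_stress (tangent T e) (fst (fst (q e))) (snd (fst (q e))) (fst (snd (q e))) (snd (snd (q e))) x)"
    unfolding local_stress_def by (intro ext sum.cong) auto
  also have "\<dots> \<in> X_elem" by (rule sum_bubble_stress_in_X_elem) (simp add: finite_E)
  finally show ?thesis .
qed

lemma elem_part_bubble_field:
  assumes "K \<in> T" shows "elem_part K (sCurl (bubble_field w)) = local_stress w K"
  unfolding elem_part_def
proof (rule the_equality)
  show P: "local_stress w K \<in> X_elem \<and> (AE x in lebesgue_on K. sCurl (bubble_field w) x = local_stress w K x)"
    using local_stress_in_X_elem AE_sCurl_bubble_field_local[OF assms] by blast
  fix P assume "P \<in> X_elem \<and> (AE x in lebesgue_on K. sCurl (bubble_field w) x = P x)"
  moreover from this P have "AE x in lebesgue_on K. P x = local_stress w K x"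
    by (auto elim: eventually_elim2)
  moreover obtain a b c where t: "triangle a b c" "K = convex hull {a, b, c}"
    using triangle_exists[OF simplex_T[OF assms]] .
  ultimately show "P = local_stress w K"
    using X_elem_AE_unique[of P "local_stress w K" K] local_stress_in_X_elem
      triangle.compact_K[OF t(1)] triangle.interior_K_nonempty[OF t(1)] by simp
qed

text \<open>The gradient of the third coordinate is orthogonal to \<open>t\<close>, and the coordinate itself is zero on \<open>e\<close>. One of the two factors
of the bubble of any other edge of the element is this coordinate.\<close>

lemma edge_traces:
  assumes e: "e \<in> E"
  defines "n \<equiv> outward_normal T e" and "t \<equiv> tangent T e"
  shows "e' \<in> E \<Longrightarrow> adj_elem T e' = adj_elem T e \<Longrightarrow> x \<in> e \<Longrightarrow> n \<bullet> (edge_stress e' x *v n) = 0"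
    and "e' \<in> E \<Longrightarrow> adj_elem T e' = adj_elem T e \<Longrightarrow> e' \<noteq> e \<Longrightarrow>
      qn_form n t (frechet_derivative (edge_stress e') (at x)) = 0"
    and "qn_form n t (frechet_derivative (edge_stress e) (at x)) = 2 / (diameter e)\<^sup>2"
proof -
  obtain a b c where tr: "triangle a b c" and K: "adj_elem T e = convex hull {a, b, c}" and ab: "e = closed_segment a b"
    using E_triangle[OF e] .
  interpret triangle a b c by (rule tr)
  obtain ga ka where la: "bary K a = (\<lambda>x. ga \<bullet> x + ka)" by (rule bary_affine[of a]) simp
  obtain gb kb where lb: "bary K b = (\<lambda>x. gb \<bullet> x + kb)" by (rule bary_affine[of b]) simp
  obtain gc kc where lc: "bary K c = (\<lambda>x. gc \<bullet> x + kc)" by (rule bary_affine[of c]) simp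
  have fr: "norm n = 1" "norm t = 1" "t = - rot90 n" "n \<bullet> t = 0" "gc \<bullet> t = 0"
    "(ga \<bullet> t) * (gb \<bullet> t) * (dist a b)\<^sup>2 = -1"
    using edge_frame[OF K[unfolded ab] la lb lc] unfolding n_def t_def ab by auto
  have rn: "rot90 n = - t" using fr(3) by simp
  have Se: "edge_stress e = bubble_stress t ga ka gb kb"
    unfolding t_def by (rule edge_stress_eq[OF tr K ab]) (simp_all add: K la lb)
  have cases: "(\<exists>g k. edge_stress e' = bubble_stress (tangent T e') g k gc kc \<or> 
      edge_stress e' = bubble_stress (tangent T e') gc kc g k) \<or> e' = e"
    if e': "e' \<in> E" "adj_elem T e' = adj_elem T e"
  proof -
    have "e' edge_of K" using E_adj(2)[OF e'(1)] e'(2) K by simp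
    then consider "e' = e" | "e' = closed_segment b c" | "e' = closed_segment c a"
      using edge_of_cases ab by blast
    then show ?thesis
    proof cases
      case 2
      have "edge_stress e' = bubble_stress (tangent T e') gb kb gc kc"
        by (rule edge_stress_eq[OF rotate _ 2]) (simp_all add: e' K K_rotate lb lc)
      then show ?thesis by blast
    next
      case 3
      have "edge_stress e' = bubble_stress (tangent T e') gc kc ga ka"
        by (rule edge_stress_eq[OF rotate' _ 3]) (simp_all add: e' K K_rotate' la lc)
      then show ?thesis by blast
    qed simp
  qed
  have D: "frechet_derivative (bubble_stress s g k g' k') (at x)
      = (\<lambda>d. symm (outer_product s (- rot90 ((g' \<bullet> d) *\<^sub>R g + (g \<bullet> d) *\<^sub>R g'))))" for s g k g' k' x
    by (rule frechet_derivative_at[OF bubble_stress_has_derivative, symmetric])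
  have qn: "qn_form n t (frechet_derivative (bubble_stress s g k g' k') (at x)) = - 2 * (g \<bullet> t) * (g' \<bullet> t) * (s \<bullet> t)"
    for s g k g' k' x
    unfolding D fr(3) by (rule qn_form_bubble[OF fr(1)])
  show "n \<bullet> (edge_stress e' x *v n) = 0" if e': "e' \<in> E" "adj_elem T e' = adj_elem T e" and x: "x \<in> e"
  proof -
    have "gc \<bullet> x + kc = 0" using x segment_ab_iff unfolding ab lc by blast
    moreover have "t \<bullet> gc = 0" using fr by (simp add: inner_commute)
    ultimately show ?thesis
      using cases[OF e'] Se fr(4) by (auto simp: nn_bubble_stress rn)
  qed
  show "qn_form n t (frechet_derivative (edge_stress e') (at x)) = 0"
    if e': "e' \<in> E" "adj_elem T e' = adj_elem T e" "e' \<noteq> e"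
    using cases[OF e'(1,2)] e'(3) fr(5) by (auto simp: qn)
  have "t \<bullet> t = 1" using fr(2) by (simp add: norm_eq_1)
  moreover have "dist a b \<noteq> 0" using distinct by simp
  moreover have "diameter e = dist a b" by (simp add: ab diameter_closed_segment)
  ultimately show "qn_form n t (frechet_derivative (edge_stress e) (at x)) = 2 / (diameter e)\<^sup>2"
    using fr(6) unfolding Se qn by (simp add: field_simps)
qed

lemma nn_trace_bubble_field:
  assumes e: "e \<in> E" and x: "x \<in> e"
  shows "nn_trace T e (sCurl (bubble_field w)) x = 0"
  unfolding nn_trace_def Let_def elem_part_bubble_field[OF E_adj(1)[OF e]] local_stress_def quad_sum
  by (rule sum.neutral) (use edge_traces(1)[OF e _ _ x] in auto)

lemma q_n_bubble_field:
  assumes e: "e \<in> E"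
  shows "q_n T e (sCurl (bubble_field w)) x = 2 * w e / (diameter e)\<^sup>2"
proof -
  let ?K = "adj_elem T e" and ?n = "outward_normal T e" and ?t = "tangent T e"
  let ?A = "{e' \<in> E. adj_elem T e' = ?K}"
  let ?D = "\<lambda>e'. frechet_derivative (edge_stress e') (at x)"
  have "(local_stress w ?K has_derivative (\<lambda>d. \<Sum>e'\<in>?A. w e' *\<^sub>R ?D e' d)) (at x)"
    unfolding local_stress_def[abs_def]
    by (intro has_derivative_sum has_derivative_scaleR_right edge_stress_has_derivative) simp
  from qn_form_derivative[OF this]
  have "q_n T e (sCurl (bubble_field w)) x = qn_form ?n ?t (\<lambda>d. \<Sum>e'\<in>?A. w e' *\<^sub>R ?D e' d)"
    by (simp add: q_n_def nt_trace_def[abs_def] elem_part_bubble_field[OF E_adj(1)[OF e]])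
  also have "\<dots> = (\<Sum>e'\<in>?A. w e' * qn_form ?n ?t (?D e'))" by (rule qn_form_sum)
  also have "\<dots> = (\<Sum>e'\<in>{e}. w e' * qn_form ?n ?t (?D e'))"
    by (rule sum.mono_neutral_right) (use finite_E e edge_traces(2)[OF e] in auto)
  also have "\<dots> = 2 * w e / (diameter e)\<^sup>2" by (simp add: edge_traces(3)[OF e])
  finally show ?thesis .
qed

lemma edge_integral_q_n_bubble_field:
  assumes e: "e \<in> E"
  shows "edge_integral e (q_n T e (sCurl (bubble_field w))) = 2 * w e / diameter e"
proof -
  obtain a b c where "triangle a b c" and ab: "e = closed_segment a b" using E_triangle[OF e] .
  have "edge_integral e (q_n T e (sCurl (bubble_field w))) = diameter e * (2 * w e / (diameter e)\<^sup>2)"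
    by (rule edge_integral_const[OF ab]) (rule q_n_bubble_field[OF e])
  then show ?thesis by (simp add: power2_eq_square)
qed

lemma diameter_edge_pos: "e \<in> E \<Longrightarrow> 0 < diameter e"
  using E_triangle diameter_closed_segment triangle.distinct(1) by (metis zero_less_dist_iff)

lemma sets_D: "D \<in> sets lebesgue"
  using domain by (simp add: bounded_lipschitz_domain_def)

text \<open>One coordinate is zero at each boundary point of the triangle, and the one that is not a factor of the bubble
is zero only on \<open>e\<close>.\<close>

lemma bubble_zero_on_frontier:
  assumes e: "e \<in> E" and x: "x \<in> frontier (adj_elem T e)" "x \<notin> e"
  shows "(\<Prod>z\<in>vertices e. bary (adj_elem T e) z x) = 0"
proof -
  obtain a b c where t: "triangle a b c" "adj_elem T e = convex hull {a, b, c}" and ab: "e = closed_segment a b"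
    using E_triangle[OF e] .
  interpret triangle a b c by (rule t)
  have "x \<in> frontier K" "x \<notin> closed_segment a b" using x t(2) ab by simp_all
  then have "bary K a x = 0 \<or> bary K b x = 0"
    using frontier_K[of x] segment_ab_iff[of x] by blast
  moreover have "(\<Prod>z\<in>vertices e. bary (adj_elem T e) z x) = bary K a x * bary K b x"
    unfolding t(2) by (simp add: ab prod_vertices_ab)
  ultimately show ?thesis by simp
qed

lemma borel_measurable_edge_stress: "e \<in> E \<Longrightarrow> edge_stress e \<in> borel_measurable borel"
  by (intro borel_measurable_continuous_onI continuous_edge_stress)

lemma adj_elem_borel: "e \<in> E \<Longrightarrow> adj_elem T e \<in> sets borel"
  by (intro borel_closed compact_imp_closed E_adj(5))

lemma AE_sCurl_bubble_field:
  "AE x in lebesgue. (\<Sum>e\<in>E. w e *\<^sub>R (indicator (adj_elem T e) x *\<^sub>R edge_stress e x)) = sCurl (bubble_field w) x"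
  using AE_off_frontiers by (rule eventually_mono) (simp add: sCurl_bubble_field)

lemma measurable_sCurl_bubble_field: "sCurl (bubble_field w) \<in> borel_measurable lebesgue"
proof (rule borel_measurable_AE[OF _ AE_sCurl_bubble_field])
  have "(\<lambda>x. \<Sum>e\<in>E. w e *\<^sub>R (indicator (adj_elem T e) x *\<^sub>R edge_stress e x)) \<in> borel_measurable borel"
    by (intro borel_measurable_sum borel_measurable_scaleR borel_measurable_const
        borel_measurable_indicator adj_elem_borel borel_measurable_edge_stress)
  then show "(\<lambda>x. \<Sum>e\<in>E. w e *\<^sub>R (indicator (adj_elem T e) x *\<^sub>R edge_stress e x)) \<in> borel_measurable lebesgue"
    by (intro measurable_completion) simp
qed

text \<open>The integral splits into integrals over the adjacent elements. In each of them the bubble is zero on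
two edges, and the Hessian of the test function is zero on the third one, as this edge does not meet the
open set \<open>D\<close>.\<close>

lemma weak_divdiv_bubble_field: "weak_divdiv D (sCurl (bubble_field w)) (\<lambda>_. 0)"
  unfolding weak_divdiv_def
proof (intro allI impI)
  fix \<phi> assume \<phi>: "test_function D \<phi>"
  note sm = test_function_smooth[OF \<phi>]
  have H0: "hessian \<phi> x = 0" if "x \<notin> D" for x
    using \<phi> that by (intro hessian_outside_support) (auto simp: test_function_def)
  let ?N = "sCurl (bubble_field w)"
  let ?F = "\<lambda>e x. indicator (adj_elem T e) x * (edge_stress e x \<bullet> hessian \<phi> x)"
  have cont: "continuous_on UNIV (\<lambda>x. edge_stress e x \<bullet> hessian \<phi> x)" if "e \<in> E" for e
    by (intro continuous_on_inner continuous_edge_stress continuous_on_hessian sm that)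
  have int: "integrable lborel (?F e)" if "e \<in> E" for e
    using integrable_indicator_compact[OF E_adj(5)[OF that] cont[OF that]] by simp
  have zero: "integral\<^sup>L lborel (?F e) = 0" if e: "e \<in> E" for e
  proof -
    obtain ga ka gb kb where P: "(\<lambda>x. \<Prod>z\<in>vertices e. bary (adj_elem T e) z x) = (\<lambda>x. (ga \<bullet> x + ka) * (gb \<bullet> x + kb))"
      and S: "edge_stress e = bubble_stress (tangent T e) ga ka gb kb" using E_stress[OF e] .
    show ?thesis unfolding S
    proof (rule integral_bubble_stress_hessian[OF E_adj(5,6)[OF e] sm])
      fix x assume x: "x \<in> frontier (adj_elem T e)"
      show "(ga \<bullet> x + ka) * (gb \<bullet> x + kb) = 0 \<or> hessian \<phi> x = 0"
      proof (cases "x \<in> e")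
        case True
        then have "x \<notin> D"
          using E_adj(3)[OF e] domain by (auto simp: bounded_lipschitz_domain_def frontier_def interior_open)
        then show ?thesis using H0 by blast
      next
        case False
        then show ?thesis using bubble_zero_on_frontier[OF e x] fun_cong[OF P, of x] by simp
      qed
    qed
  qed
  have H: "hessian \<phi> \<in> borel_measurable lebesgue"
    using borel_measurable_continuous_onI[OF continuous_on_hessian[OF sm]]
    by (intro measurable_completion) simp
  have "integral\<^sup>L (lebesgue_on D) (\<lambda>x. ?N x \<bullet> hessian \<phi> x) = integral\<^sup>L lebesgue (\<lambda>x. indicator D x *\<^sub>R (?N x \<bullet> hessian \<phi> x))"
    by (rule integral_restrict_space) (simp add: sets_D)
  also have "\<dots> = integral\<^sup>L lebesgue (\<lambda>x. ?N x \<bullet> hessian \<phi> x)"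
    by (rule Bochner_Integration.integral_cong) (use H0 in \<open>auto simp: indicator_def\<close>)
  also have "\<dots> = integral\<^sup>L lebesgue (\<lambda>x. \<Sum>e\<in>E. w e * ?F e x)"
  proof (rule integral_cong_AE)
    show "(\<lambda>x. ?N x \<bullet> hessian \<phi> x) \<in> borel_measurable lebesgue"
      by (intro borel_measurable_inner measurable_sCurl_bubble_field H)
    have "(\<lambda>x. \<Sum>e\<in>E. w e * ?F e x) \<in> borel_measurable lborel"
      by (intro borel_measurable_sum borel_measurable_times borel_measurable_const borel_measurable_integrable[OF int])
    then show "(\<lambda>x. \<Sum>e\<in>E. w e * ?F e x) \<in> borel_measurable lebesgue" by (rule measurable_completion)
    show "AE x in lebesgue. ?N x \<bullet> hessian \<phi> x = (\<Sum>e\<in>E. w e * ?F e x)"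
      using AE_sCurl_bubble_field[of w]
    proof (rule eventually_mono)
      fix x assume "(\<Sum>e\<in>E. w e *\<^sub>R (indicator (adj_elem T e) x *\<^sub>R edge_stress e x)) = ?N x"
      from this[symmetric] show "?N x \<bullet> hessian \<phi> x = (\<Sum>e\<in>E. w e * ?F e x)"
        by (simp add: inner_sum_left mult.assoc)
    qed
  qed
  also have "\<dots> = integral\<^sup>L lborel (\<lambda>x. \<Sum>e\<in>E. w e * ?F e x)"
    by (intro integral_completion borel_measurable_sum borel_measurable_times borel_measurable_const
        borel_measurable_integrable[OF int])
  also have "\<dots> = (\<Sum>e\<in>E. w e * integral\<^sup>L lborel (?F e))"
    using int by (subst Bochner_Integration.integral_sum) auto
  also have "\<dots> = 0" using zero by simp
  finally show "integral\<^sup>L (lebesgue_on D) (\<lambda>x. ?N x \<bullet> hessian \<phi> x) = integral\<^sup>L (lebesgue_on D) (\<lambda>x. 0 * \<phi> x)"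
    by simp
qed

text \<open>A point off all edges lies in one element only, which has at most three edges; hence at most three terms of the sum
are nonzero there, and their squares can be separated at the cost of a factor three.\<close>

lemma square_norm_sCurl_bubble_field_le:
  assumes M: "\<And>e x. e \<in> E \<Longrightarrow> x \<in> adj_elem T e \<Longrightarrow> norm (edge_stress e x) \<le> M e"
    and x: "x \<notin> \<Union>(frontier ` T)"
  shows "(norm (sCurl (bubble_field w) x))\<^sup>2 \<le> 3 * (\<Sum>e\<in>E. (w e * M e)\<^sup>2 * indicator (adj_elem T e) x)"
proof -
  define A where "A = {e \<in> E. x \<in> adj_elem T e}"
  have fA: "finite A" using finite_E by (simp add: A_def)
  have restrict: "(\<Sum>e\<in>E. if x \<in> adj_elem T e then f e else 0) = sum f A" for f :: "_ \<Rightarrow> real"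
    unfolding A_def by (simp add: sum.inter_filter[OF finite_E])
  have "card A \<le> 3"
  proof (cases "A = {}")
    case False
    then obtain e0 where e0: "e0 \<in> E" "x \<in> adj_elem T e0" by (auto simp: A_def)
    then have "x \<in> interior (adj_elem T e0)"
      using x E_adj(1)[OF e0(1)] closure_subset[of "adj_elem T e0"] by (auto simp: frontier_def)
    then have "A \<subseteq> {e. e edge_of adj_elem T e0}"
      using same_elem[OF E_adj(1)[OF e0(1)]] E_adj(2) by (fastforce simp: A_def)
    then have "card A \<le> card {e. e edge_of adj_elem T e0}"
      by (rule card_mono[OF finite_edges(1)[OF E_adj(4)[OF e0(1)]]])
    also have "\<dots> \<le> 3" by (rule finite_edges(2)[OF E_adj(4)[OF e0(1)]])
    finally show ?thesis .
  qed simp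
  have "norm (sCurl (bubble_field w) x) \<le> (\<Sum>e\<in>E. norm (w e *\<^sub>R (indicator (adj_elem T e) x *\<^sub>R edge_stress e x)))"
    unfolding sCurl_bubble_field[OF x] by (rule norm_sum)
  also have "\<dots> \<le> (\<Sum>e\<in>E. if x \<in> adj_elem T e then \<bar>w e\<bar> * M e else 0)"
    by (rule sum_mono) (use M in \<open>auto intro: mult_left_mono\<close>)
  also have "\<dots> = (\<Sum>e\<in>A. \<bar>w e\<bar> * M e)" by (rule restrict)
  finally have "(norm (sCurl (bubble_field w) x))\<^sup>2 \<le> (\<Sum>e\<in>A. \<bar>w e\<bar> * M e)\<^sup>2"
    by (rule power_mono) simp
  also have "\<dots> \<le> (\<Sum>e\<in>A. (\<bar>w e\<bar> * M e)\<^sup>2) * card A" by (rule sum_squared_le_sum_of_squares)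
  also have "\<dots> \<le> (\<Sum>e\<in>A. (\<bar>w e\<bar> * M e)\<^sup>2) * 3"
    using \<open>card A \<le> 3\<close> by (intro mult_left_mono sum_nonneg) auto
  also have "\<dots> = 3 * (\<Sum>e\<in>E. (w e * M e)\<^sup>2 * indicator (adj_elem T e) x)"
    unfolding restrict[symmetric] by (simp, intro sum.cong) (auto simp: power_mult_distrib)
  finally show ?thesis .
qed

lemma L2_sCurl_bubble_field:
  assumes M: "\<And>e x. e \<in> E \<Longrightarrow> x \<in> adj_elem T e \<Longrightarrow> norm (edge_stress e x) \<le> M e"
  shows "L2 D (sCurl (bubble_field w))"
    and "integral\<^sup>L (lebesgue_on D) (\<lambda>x. (norm (sCurl (bubble_field w) x))\<^sup>2)
      \<le> 3 * (\<Sum>e\<in>E. (w e * M e)\<^sup>2 * measure lebesgue (adj_elem T e))"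
proof -
  let ?f = "\<lambda>x. (norm (sCurl (bubble_field w) x))\<^sup>2"
  let ?B = "\<lambda>x. 3 * (\<Sum>e\<in>E. (w e * M e)\<^sup>2 * indicator (adj_elem T e) x)"
  have lm: "adj_elem T e \<in> lmeasurable" if "e \<in> E" for e
    using lmeasurable_compact[OF E_adj(5)[OF that]] .
  have ind: "integrable lebesgue (indicator (adj_elem T e) :: _ \<Rightarrow> real)" if "e \<in> E" for e
    using lm[OF that] by (intro integrable_real_indicator) (auto simp: fmeasurable_def)
  have B: "integrable lebesgue ?B"
    by (intro integrable_mult_right Bochner_Integration.integrable_sum ind)
  have le: "AE x in lebesgue. ?f x \<le> ?B x"
    using AE_off_frontiers by (rule eventually_mono) (rule square_norm_sCurl_bubble_field_le[OF M])
  have mf: "?f \<in> borel_measurable lebesgue"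
    using measurable_sCurl_bubble_field by measurable
  have f: "integrable lebesgue ?f"
    by (rule Bochner_Integration.integrable_bound[OF B mf])
       (use le in \<open>auto elim!: eventually_mono intro: order_trans[OF _ abs_ge_self]\<close>)
  have fD: "integrable lebesgue (\<lambda>x. indicator D x *\<^sub>R ?f x)"
    by (rule integrable_mult_indicator[OF sets_D f])
  then have "integrable (lebesgue_on D) ?f"
    by (subst integrable_restrict_space) (simp_all add: sets_D)
  moreover have "sCurl (bubble_field w) \<in> borel_measurable (lebesgue_on D)"
    by (intro measurable_restrict_space1 measurable_sCurl_bubble_field)
  ultimately show "L2 D (sCurl (bubble_field w))" by (simp add: L2_def)
  have "integral\<^sup>L (lebesgue_on D) ?f = integral\<^sup>L lebesgue (\<lambda>x. indicator D x *\<^sub>R ?f x)"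
    by (rule integral_restrict_space) (simp add: sets_D)
  also have "\<dots> \<le> integral\<^sup>L lebesgue ?B"
  proof (rule integral_mono_AE[OF fD B], use le in \<open>rule eventually_mono\<close>)
    fix x assume "?f x \<le> ?B x"
    moreover have "indicator D x *\<^sub>R ?f x \<le> ?f x" by (simp add: indicator_def)
    ultimately show "indicator D x *\<^sub>R ?f x \<le> ?B x" by (rule order_trans[rotated])
  qed
  also have "\<dots> = 3 * (\<Sum>e\<in>E. (w e * M e)\<^sup>2 * measure lebesgue (adj_elem T e))"
    using ind by (simp add: Bochner_Integration.integral_sum)
  finally show "integral\<^sup>L (lebesgue_on D) ?f \<le> 3 * (\<Sum>e\<in>E. (w e * M e)\<^sup>2 * measure lebesgue (adj_elem T e))" .
qed

lemma sCurl_bubble_field_in_Hdivdiv: "sCurl (bubble_field w) \<in> Hdivdiv D"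
proof -
  have "\<exists>M. \<forall>x\<in>adj_elem T e. norm (edge_stress e x) \<le> M" if "e \<in> E" for e
  proof -
    have "compact (edge_stress e ` adj_elem T e)"
      using E_adj(5)[OF that] continuous_edge_stress[OF that] continuous_on_subset
      by (blast intro: compact_continuous_image)
    then have "bounded (edge_stress e ` adj_elem T e)" by (rule compact_imp_bounded)
    then show ?thesis by (auto simp: bounded_iff)
  qed
  then obtain M where "\<And>e x. e \<in> E \<Longrightarrow> x \<in> adj_elem T e \<Longrightarrow> norm (edge_stress e x) \<le> M e" by metis
  then have "L2 D (sCurl (bubble_field w))" by (rule L2_sCurl_bubble_field(1))
  moreover have "transpose (sCurl (bubble_field w) x) = sCurl (bubble_field w) x" for x
    by (simp add: sCurl_def symm_def transpose_def vec_eq_iff add.commute)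
  moreover have "L2 D (\<lambda>_. 0 :: real)" by (simp add: L2_def)
  ultimately show ?thesis using weak_divdiv_bubble_field unfolding Hdivdiv_def by blast
qed

lemma sCurl_bubble_field_in_Sigma_nn_ker: "sCurl (bubble_field w) \<in> Sigma_nn D T \<inter> ker_divdiv D"
proof -
  have "sCurl (bubble_field w) \<in> X_space D T"
    unfolding X_space_def
    using sCurl_bubble_field_in_Hdivdiv AE_sCurl_bubble_field_local local_stress_in_X_elem by blast
  then have "sCurl (bubble_field w) \<in> Sigma_nn D T"
    using nn_trace_bubble_field unfolding Sigma_nn_def by blast
  moreover have "sCurl (bubble_field w) \<in> ker_divdiv D"
    using sCurl_bubble_field_in_Hdivdiv weak_divdiv_bubble_field unfolding ker_divdiv_def by blast
  ultimately show ?thesis by blast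
qed

lemma adj_elem_diameter_pos:
  assumes e: "e \<in> E" shows "0 < diameter (adj_elem T e)"
proof -
  obtain a b c where t: "triangle a b c" "adj_elem T e = convex hull {a, b, c}" using E_triangle[OF e] .
  have "dist a b \<le> diameter (adj_elem T e)"
    by (rule diameter_bounded_bound) (auto simp: t(2) hull_inc intro: compact_imp_bounded triangle.compact_K[OF t(1)])
  moreover have "0 < dist a b" using triangle.distinct(1)[OF t(1)] by simp
  ultimately show ?thesis by linarith
qed

lemma norm_edge_stress_le:
  assumes e: "e \<in> E" and x: "x \<in> adj_elem T e"
    and \<sigma>: "diameter (adj_elem T e) \<le> \<sigma> * inscribed_diameter (adj_elem T e)" "0 \<le> \<sigma>"
  shows "norm (edge_stress e x) \<le> 2 * \<sigma> / diameter (adj_elem T e)"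
proof -
  let ?d = "diameter (adj_elem T e)"
  obtain a b c where t: "triangle a b c" and K: "adj_elem T e = convex hull {a, b, c}" and ab: "e = closed_segment a b"
    using E_triangle[OF e] .
  interpret triangle a b c by (rule t)
  obtain ga ka where la: "bary K a = (\<lambda>x. ga \<bullet> x + ka)" by (rule bary_affine[of a]) simp
  obtain gb kb where lb: "bary K b = (\<lambda>x. gb \<bullet> x + kb)" by (rule bary_affine[of b]) simp
  obtain gc kc where lc: "bary K c = (\<lambda>x. gc \<bullet> x + kc)" by (rule bary_affine[of c]) simp
  have S: "edge_stress e = bubble_stress (tangent T e) ga ka gb kb"
    by (rule edge_stress_eq[OF t K ab]) (simp_all add: K la lb)
  have tan: "norm (tangent T e) = 1"
    using edge_frame(2)[OF K[unfolded ab] la lb lc] ab by simp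
  have grad: "norm g \<le> \<sigma> / ?d" if "z \<in> {a, b, c}" "bary K z = (\<lambda>x. g \<bullet> x + k)" for z g k
  proof -
    have "norm g * inscribed_diameter K \<le> 1"
      by (rule gradient_inscribed_diameter_le[OF compact_K, of _ k])
         (use bary_le_1[OF _ that(1)] that(2) in auto)
    then have "\<sigma> * (norm g * inscribed_diameter K) \<le> \<sigma> * 1" by (rule mult_left_mono[OF _ \<sigma>(2)])
    moreover have "norm g * ?d \<le> norm g * (\<sigma> * inscribed_diameter K)"
      using \<sigma>(1) unfolding K by (rule mult_left_mono) simp
    ultimately have "norm g * ?d \<le> \<sigma>" by (simp add: algebra_simps)
    then show ?thesis using adj_elem_diameter_pos[OF e] by (simp add: field_simps)
  qed
  have l: "\<bar>ga \<bullet> x + ka\<bar> \<le> 1" "\<bar>gb \<bullet> x + kb\<bar> \<le> 1"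
    using bary_le_1[of x a] bary_le_1[of x b] x unfolding K la lb by auto
  have "norm (edge_stress e x) \<le> \<bar>gb \<bullet> x + kb\<bar> * norm ga + \<bar>ga \<bullet> x + ka\<bar> * norm gb"
    using norm_bubble_stress_le[of "tangent T e" ga ka gb kb x] by (simp add: S tan)
  also have "\<dots> \<le> 1 * norm ga + 1 * norm gb"
    by (intro add_mono mult_right_mono l) auto
  also have "\<dots> \<le> \<sigma> / ?d + \<sigma> / ?d"
    using grad[OF _ la] grad[OF _ lb] by simp
  finally show ?thesis by simp
qed

lemma measure_adj_elem_le:
  assumes e: "e \<in> E" shows "measure lebesgue (adj_elem T e) \<le> pi * (diameter (adj_elem T e))\<^sup>2"
proof -
  let ?K = "adj_elem T e"
  obtain z where z: "z \<in> ?K" using adj_elem_diameter_pos[OF e] by fastforce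
  have "?K \<subseteq> cball z (diameter ?K)"
    using diameter_bounded_bound[OF compact_imp_bounded[OF E_adj(5)[OF e]] z] by auto
  then have "measure lebesgue ?K \<le> measure lebesgue (cball z (diameter ?K))"
    using lmeasurable_compact[OF E_adj(5)[OF e]] by (intro measure_mono_fmeasurable) (auto simp: fmeasurableD)
  also have "\<dots> = pi * (diameter ?K)\<^sup>2"
    using content_cball_plane[of "diameter ?K" z] adj_elem_diameter_pos[OF e] by simp
  finally show ?thesis .
qed

text \<open>On its element, an edge contributes at most \<open>\<pi> h\<^sub>K\<^sup>2 (2 \<sigma> w / h\<^sub>K)\<^sup>2 = 4 \<pi> \<sigma>\<^sup>2 w\<^sup>2\<close> to the squared norm, in which the mesh size
cancels; the factor three for overlapping contributions gives the constant.\<close>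

lemma L2_norm_sCurl_bubble_field_le:
  assumes \<sigma>: "\<And>K. K \<in> T \<Longrightarrow> diameter K \<le> \<sigma> * inscribed_diameter K" "0 \<le> \<sigma>"
  shows "L2_norm_on D (sCurl (bubble_field w)) \<le> sqrt (12 * pi) * \<sigma> * sqrt (\<Sum>e\<in>E. (w e)\<^sup>2)"
proof -
  let ?d = "\<lambda>e. diameter (adj_elem T e)"
  have "integral\<^sup>L (lebesgue_on D) (\<lambda>x. (norm (sCurl (bubble_field w) x))\<^sup>2)
      \<le> 3 * (\<Sum>e\<in>E. (w e * (2 * \<sigma> / ?d e))\<^sup>2 * measure lebesgue (adj_elem T e))"
    using \<sigma> E_adj(1) by (intro L2_sCurl_bubble_field(2) norm_edge_stress_le) auto
  also have "\<dots> \<le> 3 * (\<Sum>e\<in>E. 4 * pi * \<sigma>\<^sup>2 * (w e)\<^sup>2)"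
  proof (intro mult_left_mono sum_mono)
    fix e assume e: "e \<in> E"
    have "(w e * (2 * \<sigma> / ?d e))\<^sup>2 * measure lebesgue (adj_elem T e) \<le> (w e * (2 * \<sigma> / ?d e))\<^sup>2 * (pi * (?d e)\<^sup>2)"
      by (intro mult_left_mono measure_adj_elem_le e) auto
    also have "\<dots> = 4 * pi * \<sigma>\<^sup>2 * (w e)\<^sup>2"
      using adj_elem_diameter_pos[OF e] by (simp add: power_mult_distrib power_divide)
    finally show "(w e * (2 * \<sigma> / ?d e))\<^sup>2 * measure lebesgue (adj_elem T e) \<le> 4 * pi * \<sigma>\<^sup>2 * (w e)\<^sup>2" .
  qed simp
  also have "\<dots> = 12 * pi * \<sigma>\<^sup>2 * (\<Sum>e\<in>E. (w e)\<^sup>2)" by (simp flip: sum_distrib_left)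
  finally have "L2_norm_on D (sCurl (bubble_field w)) \<le> sqrt (12 * pi * \<sigma>\<^sup>2 * (\<Sum>e\<in>E. (w e)\<^sup>2))"
    unfolding L2_norm_on_def by (rule real_sqrt_le_mono)
  also have "\<dots> = sqrt (12 * pi) * \<sigma> * sqrt (\<Sum>e\<in>E. (w e)\<^sup>2)"
    using \<sigma>(2) by (simp add: real_sqrt_mult)
  finally show ?thesis .
qed

end

section \<open>Prescribed edge integrals of \<open>q\<^sub>n\<close>\<close>

theorem lemma4p4:
  fixes \<Omega> :: "(real^2) set"
    and \<Gamma> :: "nat \<Rightarrow> (real^2) set"
    and \<gamma> :: "nat \<Rightarrow> real \<Rightarrow> real^2"
    and H :: nat
    and I :: "real set"
    and \<Omega>h :: "real \<Rightarrow> (real^2) set"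
    and \<Gamma>h :: "real \<Rightarrow> nat \<Rightarrow> (real^2) set"
    and \<T> :: "real \<Rightarrow> (real^2) set set"
  assumes domain: "bounded_lipschitz_domain \<Omega>"
    and components_\<Omega>: "bij_betw \<Gamma> {..H} (components (frontier \<Omega>))"
    and orientation: "\<And>i. i \<le> H \<Longrightarrow> right_oriented_param \<Omega> (\<Gamma> i) (\<gamma> i)"
    and mesh_parameters: "I \<subseteq> {0<..}" "0 islimpt I"
    and domains_h: "\<And>h. h \<in> I \<Longrightarrow> bounded_lipschitz_domain (\<Omega>h h) \<and> polygonal_boundary (\<Omega>h h)"
    and components_h: "\<And>h. h \<in> I \<Longrightarrow> bij_betw (\<Gamma>h h) {..H} (components (frontier (\<Omega>h h)))"
    and meshes: "\<And>h. h \<in> I \<Longrightarrow> conforming_triangulation (\<Omega>h h) (\<T> h)"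
    and mesh_size: "\<And>h. h \<in> I \<Longrightarrow> mesh_size (\<T> h) = h"
    and shape_regular: "uniformly_shape_regular I \<T>"
    and quasi_uniform: "quasi_uniform I \<T>"
    and hausdorff: "((\<lambda>h. hausdorff_distance (frontier (\<Omega>h h)) (frontier \<Omega>)) \<longlongrightarrow> 0) (at 0 within I)"
    and interpolation: "\<And>h i. h \<in> I \<Longrightarrow> i \<le> H \<Longrightarrow>
           interpolates_component (\<Omega>h h) (\<T> h) (\<Gamma>h h i) (\<gamma> i)"
  shows "\<exists>C. \<forall>h\<in>I. \<forall>N \<in> X_space (\<Omega>h h) (\<T> h).
    (let E = bd_edges (\<Omega>h h) (\<T> h);
         \<mu> = (\<lambda>e. edge_integral e (q_n (\<T> h) e N));
         p = (\<lambda>x. (1/2) *\<^sub>R (\<Sum>e\<in>E. (diameter e * \<mu> e * edge_bubble (\<T> h) e x) *\<^sub>R tangent (\<T> h) e))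
     in sCurl p \<in> Sigma_nn (\<Omega>h h) (\<T> h) \<inter> ker_divdiv (\<Omega>h h) \<and>
        (\<forall>e\<in>E. (\<forall>x\<in>e. nn_trace (\<T> h) e (sCurl p) x = 0) \<and>
               edge_integral e (q_n (\<T> h) e (sCurl p)) = \<mu> e) \<and>
        L2_norm_on (\<Omega>h h) (sCurl p) \<le> C * sqrt (\<Sum>e\<in>E. (diameter e)\<^sup>2 * \<bar>\<mu> e\<bar>\<^sup>2))"
proof -
  obtain \<sigma> where \<sigma>: "\<sigma> > 0" "\<And>h K. h \<in> I \<Longrightarrow> K \<in> \<T> h \<Longrightarrow> diameter K \<le> \<sigma> * inscribed_diameter K"
    using shape_regular unfolding uniformly_shape_regular_def by blast
  show ?thesis unfolding Let_def
  proof (intro exI[of _ "sqrt (3 * pi) * \<sigma>"] ballI)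
    fix h N assume h: "h \<in> I"
    interpret lipschitz_mesh "\<Omega>h h" "\<T> h"
      by unfold_locales (use domains_h meshes h in auto)
    define \<mu> where "\<mu> e = edge_integral e (q_n (\<T> h) e N)" for e
    \<comment> \<open>With these weights the edge integrals \<open>2 w / h\<^sub>e\<close> become \<open>\<mu>\<^sub>e\<close>.\<close>
    define w where "w e = diameter e * \<mu> e / 2" for e
    have p: "(\<lambda>x. (1/2) *\<^sub>R (\<Sum>e\<in>E. (diameter e * \<mu> e * edge_bubble (\<T> h) e x) *\<^sub>R tangent (\<T> h) e)) = bubble_field w"
      by (simp add: bubble_field_def w_def fun_eq_iff scaleR_sum_right mult.assoc)
    have "L2_norm_on (\<Omega>h h) (sCurl (bubble_field w)) \<le> sqrt (12 * pi) * \<sigma> * sqrt (\<Sum>e\<in>E. (w e)\<^sup>2)"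
      by (rule L2_norm_sCurl_bubble_field_le) (use \<sigma> h in auto)
    also have "(\<Sum>e\<in>E. (w e)\<^sup>2) = (\<Sum>e\<in>E. (diameter e)\<^sup>2 * \<bar>\<mu> e\<bar>\<^sup>2) / 4"
      by (simp add: w_def power_mult_distrib power_divide sum_divide_distrib)
    also have "sqrt (12 * pi) * \<sigma> * sqrt ((\<Sum>e\<in>E. (diameter e)\<^sup>2 * \<bar>\<mu> e\<bar>\<^sup>2) / 4)
        = sqrt (3 * pi) * \<sigma> * sqrt (\<Sum>e\<in>E. (diameter e)\<^sup>2 * \<bar>\<mu> e\<bar>\<^sup>2)"
      using real_sqrt_mult[of 4 "3 * pi"] by (simp add: real_sqrt_divide)
    finally have bound: "L2_norm_on (\<Omega>h h) (sCurl (bubble_field w))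
        \<le> sqrt (3 * pi) * \<sigma> * sqrt (\<Sum>e\<in>E. (diameter e)\<^sup>2 * \<bar>\<mu> e\<bar>\<^sup>2)" .
    have "edge_integral e (q_n (\<T> h) e (sCurl (bubble_field w))) = \<mu> e" if "e \<in> E" for e
      using edge_integral_q_n_bubble_field[OF that, of w] diameter_edge_pos[OF that] by (simp add: w_def)
    then show "sCurl (\<lambda>x. (1/2) *\<^sub>R (\<Sum>e\<in>E. (diameter e * edge_integral e (q_n (\<T> h) e N) *
              edge_bubble (\<T> h) e x) *\<^sub>R tangent (\<T> h) e)) \<in> Sigma_nn (\<Omega>h h) (\<T> h) \<inter> ker_divdiv (\<Omega>h h) \<and>
        (\<forall>e\<in>E. (\<forall>x\<in>e. nn_trace (\<T> h) e (sCurl (\<lambda>x. (1/2) *\<^sub>R (\<Sum>e\<in>E. (diameter e *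
              edge_integral e (q_n (\<T> h) e N) * edge_bubble (\<T> h) e x) *\<^sub>R tangent (\<T> h) e))) x = 0) \<and>
            edge_integral e (q_n (\<T> h) e (sCurl (\<lambda>x. (1/2) *\<^sub>R (\<Sum>e\<in>E. (diameter e *
              edge_integral e (q_n (\<T> h) e N) * edge_bubble (\<T> h) e x) *\<^sub>R tangent (\<T> h) e))))
              = edge_integral e (q_n (\<T> h) e N)) \<and>
        L2_norm_on (\<Omega>h h) (sCurl (\<lambda>x. (1/2) *\<^sub>R (\<Sum>e\<in>E. (diameter e * edge_integral e (q_n (\<T> h) e N) *
              edge_bubble (\<T> h) e x) *\<^sub>R tangent (\<T> h) e)))
          \<le> sqrt (3 * pi) * \<sigma> * sqrt (\<Sum>e\<in>E. (diameter e)\<^sup>2 * \<bar>edge_integral e (q_n (\<T> h) e N)\<bar>\<^sup>2)"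
      using sCurl_bubble_field_in_Sigma_nn_ker nn_trace_bubble_field bound
      unfolding \<mu>_def[symmetric] p by blast
  qed
qed

end
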